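(* Let $k,m\in\mathbb{N}$. Let $(X_k,\sigma)$ be the full $k$-shift. Let $\varphi_1,\varphi_2$ be two elements of the stabilized automorphism group $\mathrm{Aut}^\infty(X_k,\sigma)$ for which every orbit has size $m$. Then $\varphi_1$ and $\varphi_2$ are conjugate in the group $\mathrm{Aut}^\infty(X_k,\sigma)$.
   Context: $\mathbb{N}=\{1,2,\dots\}$. The full $k$-shift is $X_k=\mathcal{S}^{\mathbb{Z}}$ with $|\mathcal{S}|=k$, with the product of discrete topologies and the left shift $\sigma(x)_i=x_{i+1}$. $\mathrm{Aut}(X,f)$ is the group of self-homeomorphisms of $X$ commuting with $f$. The stabilized automorphism group is $\mathrm{Aut}^\infty(X,f)=\bigcup_{n\in\mathbb{N}}\mathrm{Aut}(X,f^n)$. The orbit of $x$ under $\varphi$ is $\{\varphi^n(x): n\in\mathbb{Z}\}$. *)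

theory Defs
  imports "HOL-Analysis.Analysis" "HOL-Algebra.Bij"
begin

text \<open>
  Self-maps of a space are elements of \<open>BijGroup (topspace T)\<close>, that is, extensional
  bijections under composition. When \<open>topspace T = UNIV\<close>, as for the full shift below, every
  function is extensional and the group operation is ordinary composition.
\<close>

definition aut :: "'x topology \<Rightarrow> ('x \<Rightarrow> 'x) \<Rightarrow> ('x \<Rightarrow> 'x) set" where
  "aut T f = {\<phi> \<in> Bij (topspace T).
     homeomorphic_map T T \<phi> \<and> (\<forall>x\<in>topspace T. \<phi> (f x) = f (\<phi> x))}"

definition stab_aut :: "'x topology \<Rightarrow> ('x \<Rightarrow> 'x) \<Rightarrow> ('x \<Rightarrow> 'x) set" where
  "stab_aut T f = (\<Union>n\<in>{1::nat..}. aut T (f ^^ n))"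

definition StabAutGroup :: "'x topology \<Rightarrow> ('x \<Rightarrow> 'x) \<Rightarrow> ('x \<Rightarrow> 'x) monoid" where
  "StabAutGroup T f = (BijGroup (topspace T)) \<lparr>carrier := stab_aut T f\<rparr>"

text \<open>
  Two-sided orbit: the exponent ranges over all integers, powers being taken in a group \<open>G\<close> of maps.
\<close>

definition orbit_in :: "('x \<Rightarrow> 'x) monoid \<Rightarrow> ('x \<Rightarrow> 'x) \<Rightarrow> 'x \<Rightarrow> 'x set" where
  "orbit_in G \<phi> x = {(\<phi> [^]\<^bsub>G\<^esub> n) x | n. n \<in> (UNIV :: int set)}"

text \<open>
  The alphabet of the full shift is the set of all elements of the finite type \<open>'a\<close>, so that
  \<open>k = CARD('a)\<close>.
\<close>

definition full_shift :: "(int \<Rightarrow> 'a::finite) topology" where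
  "full_shift = product_topology (\<lambda>_. discrete_topology UNIV) UNIV"

definition shift :: "(int \<Rightarrow> 'a) \<Rightarrow> int \<Rightarrow> 'a" where
  "shift x = (\<lambda>i. x (i + 1))"

lemma topspace_full_shift [simp]: "topspace full_shift = UNIV"
  by (simp add: full_shift_def)

lemma funpow_commute_power:
  assumes "\<forall>x\<in>S. \<phi> (g x) = g (\<phi> x)" "g \<in> S \<rightarrow> S" "x \<in> S"
  shows "\<phi> ((g ^^ n) x) = (g ^^ n) (\<phi> x) \<and> (g ^^ n) x \<in> S"
  using assms by (induction n) auto

lemma funpow_funcset: "f \<in> S \<rightarrow> S \<Longrightarrow> f ^^ n \<in> S \<rightarrow> S"
  by (induction n) auto

lemma aut_mono_power:
  assumes "f \<in> topspace T \<rightarrow> topspace T"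
  shows "aut T (f ^^ n) \<subseteq> aut T (f ^^ (n * m))"
  using funpow_commute_power[OF _ funpow_funcset[OF assms], of _ n _ m]
  by (auto simp: aut_def funpow_mult mult.commute)

lemma aut_compose:
  assumes "\<phi> \<in> aut T f" "\<psi> \<in> aut T f" "f \<in> topspace T \<rightarrow> topspace T"
  shows "compose (topspace T) \<phi> \<psi> \<in> aut T f"
proof -
  have "homeomorphic_map T T (compose (topspace T) \<phi> \<psi>)"
    by (rule homeomorphic_map_eq[OF homeomorphic_map_compose[of T T \<psi> T \<phi>]])
      (use assms in \<open>auto simp: aut_def compose_eq\<close>)
  moreover have "\<psi> \<in> topspace T \<rightarrow> topspace T"
    using assms by (auto simp: aut_def dest: Bij_imp_funcset)
  ultimately show ?thesis
    using assms by (auto simp: aut_def compose_Bij compose_eq Pi_iff)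
qed

lemma aut_inv:
  assumes "\<phi> \<in> aut T f" "f \<in> topspace T \<rightarrow> topspace T"
  shows "restrict (inv_into (topspace T) \<phi>) (topspace T) \<in> aut T f"
proof -
  let ?S = "topspace T" and ?\<psi> = "inv_into (topspace T) \<phi>"
  have B: "\<phi> \<in> Bij ?S" and h: "homeomorphic_map T T \<phi>"
    and c: "\<forall>x\<in>?S. \<phi> (f x) = f (\<phi> x)"
    using assms by (auto simp: aut_def)
  have im: "\<phi> ` ?S = ?S" and inj: "inj_on \<phi> ?S"
    using B by (auto simp: Bij_def bij_betw_def)
  obtain g where g: "homeomorphic_maps T T \<phi> g"
    using h homeomorphic_map_maps by blast
  have gS: "g y \<in> ?S" "\<phi> (g y) = y" if "y \<in> ?S" for y
    using g that by (auto simp: homeomorphic_maps_def continuous_map_def Pi_iff)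
  have eq: "?\<psi> y = g y" if "y \<in> ?S" for y
    using gS[OF that] inj by (metis inv_into_f_f)
  have "homeomorphic_map T T (restrict ?\<psi> ?S)"
    by (rule homeomorphic_map_eq[of T T g])
      (use g eq in \<open>auto simp: homeomorphic_maps_map\<close>)
  moreover have "g (f y) = f (g y)" if "y \<in> ?S" for y
    using c gS[OF that] assms(2) that inj eq by (metis PiE inv_into_f_f)
  ultimately show ?thesis
    using B assms(2) gS eq by (auto simp: aut_def restrict_inv_into_Bij Pi_iff)
qed

lemma group_StabAutGroup:
  assumes f: "f \<in> topspace T \<rightarrow> topspace T"
  shows "group (StabAutGroup T f)"
proof -
  let ?S = "topspace T"
  interpret G: group "BijGroup ?S"
    by (rule group_BijGroup)
  have fn: "f ^^ n \<in> ?S \<rightarrow> ?S" for n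
    using f by (rule funpow_funcset)
  have sub: "stab_aut T f \<subseteq> Bij ?S"
    by (auto simp: stab_aut_def aut_def)
  have "subgroup (stab_aut T f) (BijGroup ?S)"
  proof (rule G.subgroupI)
    show "stab_aut T f \<subseteq> carrier (BijGroup ?S)"
      using sub by (simp add: BijGroup_def)
    have "homeomorphic_map T T (\<lambda>x\<in>?S. x)"
      by (rule homeomorphic_map_eq[of T T id]) auto
    then have "(\<lambda>x\<in>?S. x) \<in> aut T (f ^^ 1)"
      using f by (auto simp: aut_def id_Bij Pi_iff)
    then show "stab_aut T f \<noteq> {}"
      unfolding stab_aut_def by blast
  next
    fix \<phi> assume "\<phi> \<in> stab_aut T f"
    then obtain n :: nat where n: "n \<ge> 1" "\<phi> \<in> aut T (f ^^ n)"
      by (auto simp: stab_aut_def)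
    then have "inv\<^bsub>BijGroup ?S\<^esub> \<phi> = restrict (inv_into ?S \<phi>) ?S"
      by (intro inv_BijGroup) (simp add: aut_def)
    with n aut_inv[OF n(2) fn] show "inv\<^bsub>BijGroup ?S\<^esub> \<phi> \<in> stab_aut T f"
      by (auto simp: stab_aut_def)
  next
    fix \<phi> \<psi> assume *: "\<phi> \<in> stab_aut T f" "\<psi> \<in> stab_aut T f"
    then obtain n m :: nat where n: "n \<ge> 1" "\<phi> \<in> aut T (f ^^ n)"
      and m: "m \<ge> 1" "\<psi> \<in> aut T (f ^^ m)"
      by (auto simp: stab_aut_def)
    have "\<phi> \<in> aut T (f ^^ (n * m))" "\<psi> \<in> aut T (f ^^ (n * m))"
      using aut_mono_power[OF f, of n m] aut_mono_power[OF f, of m n] n m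
      by (auto simp: mult.commute)
    then have "compose ?S \<phi> \<psi> \<in> aut T (f ^^ (n * m))"
      by (rule aut_compose[OF _ _ fn])
    moreover have "n * m \<ge> 1"
      using n m by simp
    ultimately have "compose ?S \<phi> \<psi> \<in> stab_aut T f"
      unfolding stab_aut_def by blast
    then show "\<phi> \<otimes>\<^bsub>BijGroup ?S\<^esub> \<psi> \<in> stab_aut T f"
      using * sub by (auto simp: BijGroup_def)
  qed
  then show ?thesis
    unfolding StabAutGroup_def by (rule G.subgroup_imp_group)
qed

end

theory Submission
  imports Defs
begin

text \<open>
  Let \<open>\<phi>\<close> commute with \<open>\<sigma>^n\<close> and have all orbits of size \<open>m\<close>, so that \<open>\<phi>\<close> generates a free action
  of the cyclic group of order \<open>m\<close>. For a large radius \<open>r\<close> call the central windows of all the points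
  \<open>\<phi>^j x\<close> together the state of \<open>x\<close>. This is a Markov recoding on whose states \<open>\<phi>\<close> acts freely.
  Over a long block of length \<open>2M\<close>, fullness of the shift makes the number of blocks between the
  states \<open>v\<close> and \<open>w\<close> a product \<open>f(v) e(w)\<close>, where \<open>f\<close> and \<open>e\<close> are necessarily \<open>\<phi>\<close>-invariant. Hence
  blocks can be relabelled, independently for different pairs of states and consistently along
  \<open>\<phi>\<close>-orbits, by pairs \<open>(a, b)\<close> with \<open>a < f(v)\<close> and \<open>b < e(w)\<close>. Grouping at each position the state
  with the adjacent halves of the two labels gives unconstrained symbols. In this coding
  \<open>\<sigma>^(2M)\<close> is a full shift and \<open>\<phi>\<close> is a free rotation of the alphabet, which up to relabelling
  depends only on \<open>m\<close> and \<open>k^(2M)\<close>. Using the same \<open>M\<close> for both maps conjugates them.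
\<close>

section \<open>Cyclic actions and cylinder sets\<close>

text \<open>Both images are in bijection with the classes of the common kernel. Counting by
  \<open>card\<close> is thereby reduced to comparing which points are identified.\<close>

lemma card_image_eq_if_same_kernel:
  assumes "\<And>x y. x \<in> A \<Longrightarrow> y \<in> A \<Longrightarrow> f x = f y \<longleftrightarrow> g x = g y"
  shows "card (f ` A) = card (g ` A)"
proof -
  have fg: "f (inv_into A g (g x)) = f x" if "x \<in> A" for x
    using that assms by (metis f_inv_into_f image_eqI inv_into_into)
  have "bij_betw (\<lambda>v. f (inv_into A g v)) (g ` A) (f ` A)"
    unfolding bij_betw_def inj_on_def
    using fg assms by (auto simp: image_image)
  then show ?thesis
    by (simp add: bij_betw_same_card)
qed

text \<open>Pick one representative in each orbit and count the steps from it. Period m makes every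
  orbit a cycle, and freeness makes the count below m unique.\<close>

lemma cyclic_coordinate:
  fixes P :: "'v \<Rightarrow> 'v" and m :: nat
  assumes "m \<ge> 1"
    and V: "\<And>v. v \<in> V \<Longrightarrow> P v \<in> V"
    and per: "\<And>v. v \<in> V \<Longrightarrow> (P ^^ m) v = v"
    and free: "\<And>v j. v \<in> V \<Longrightarrow> 0 < j \<Longrightarrow> j < m \<Longrightarrow> (P ^^ j) v \<noteq> v"
  obtains d :: "'v \<Rightarrow> nat" where "\<And>v. v \<in> V \<Longrightarrow> d v < m"
    and "\<And>v. v \<in> V \<Longrightarrow> d (P v) = Suc (d v) mod m"
proof -
  define O' where "O' v = {(P ^^ j) v | j. True}" for v
  \<comment> \<open>The choice depends on v only through the set \<open>O' v\<close>, so it is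
    constant on orbits once \<open>O'\<close> is.\<close>
  define \<rho> where "\<rho> v = (SOME w. w \<in> O' v)" for v
  define d where "d v = (LEAST j. (P ^^ j) (\<rho> v) = v)" for v
  have VV: "(P ^^ j) v \<in> V" if "v \<in> V" for v j
    using that V by (induction j) auto
  have red: "(P ^^ j) v = (P ^^ (j mod m)) v" if "v \<in> V" for v j
    by (rule funpow_mod_eq[OF per[OF that], symmetric])
  have O_P: "O' (P v) = O' v" if "v \<in> V" for v
  proof -
    have "(P ^^ j) v \<in> O' (P v)" for j
    proof -
      \<comment> \<open>A full turn is added so that one application of P can be split off even for
        j = 0.\<close>
      have "(P ^^ j) v = (P ^^ (j + m)) v"
        using per[OF that] by (simp add: funpow_add)
      also have "\<dots> = (P ^^ (j + m - 1)) (P v)"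
        using \<open>m \<ge> 1\<close> by (metis Nat.add_diff_assoc Suc_diff_1 add_gr_0 funpow_swap1 funpow.simps(2) comp_apply less_eq_Suc_le One_nat_def)
      finally show ?thesis unfolding O'_def by blast
    qed
    moreover have "(P ^^ j) (P v) = (P ^^ Suc j) v" for j
      by (simp add: funpow_swap1)
    ultimately show ?thesis unfolding O'_def by blast
  qed
  have \<rho>: "\<rho> v \<in> V" "\<exists>j<m. (P ^^ j) (\<rho> v) = v" if "v \<in> V" for v
  proof -
    have "v \<in> O' v" unfolding O'_def by (auto intro: exI[of _ 0])
    then have "\<rho> v \<in> O' v" unfolding \<rho>_def by (rule someI)
    then obtain j where j: "\<rho> v = (P ^^ j) v" unfolding O'_def by blast
    then have j': "\<rho> v = (P ^^ (j mod m)) v" using red[OF that] by simp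
    show "\<rho> v \<in> V" using j VV that by simp
    let ?k = "m - j mod m"
    have "(P ^^ ?k) (\<rho> v) = (P ^^ (?k + j mod m)) v"
      using j' by (simp add: funpow_add)
    also have "\<dots> = v" using per[OF that] \<open>m \<ge> 1\<close> by simp
    finally have "(P ^^ (?k mod m)) (\<rho> v) = v"
      using red[OF \<open>\<rho> v \<in> V\<close>] by simp
    then show "\<exists>j<m. (P ^^ j) (\<rho> v) = v"
      using \<open>m \<ge> 1\<close> by (intro exI[of _ "?k mod m"]) auto
  qed
  have d: "d v < m" "(P ^^ d v) (\<rho> v) = v" if "v \<in> V" for v
    using \<rho>(2)[OF that] unfolding d_def
    by (metis (mono_tags, lifting) LeastI order.strict_trans1 Least_le, metis (mono_tags, lifting) LeastI)
  have uniq: "i = j" if "v \<in> V" "i < m" "j < m" "i \<le> j" "(P ^^ i) v = (P ^^ j) v" for v i j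
  proof (rule ccontr)
    assume "i \<noteq> j"
    have "(P ^^ (j - i)) ((P ^^ i) v) = (P ^^ i) v"
      using that(4,5) by (metis comp_apply funpow_add le_add_diff_inverse2)
    then show False
      using free[OF VV[OF that(1), of i], of "j - i"] that(2-4) \<open>i \<noteq> j\<close> by simp
  qed
  have "d (P v) = Suc (d v) mod m" if "v \<in> V" for v
  proof -
    have \<rho>P: "\<rho> (P v) = \<rho> v" unfolding \<rho>_def O_P[OF that] ..
    have "(P ^^ d (P v)) (\<rho> v) = P v"
      using d(2)[OF V[OF that]] \<rho>P by simp
    also have "\<dots> = (P ^^ Suc (d v)) (\<rho> v)"
      using d(2)[OF that] by simp
    also have "\<dots> = (P ^^ (Suc (d v) mod m)) (\<rho> v)"
      by (rule red) (rule \<rho>(1)[OF that])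
    finally show ?thesis
      using uniq[OF \<rho>(1)[OF that], of "d (P v)" "Suc (d v) mod m"]
        uniq[OF \<rho>(1)[OF that], of "Suc (d v) mod m" "d (P v)"]
        d(1)[OF V[OF that]] \<open>m \<ge> 1\<close> by (cases "d (P v) \<le> Suc (d v) mod m") auto
  qed
  with d(1) show thesis using that by blast
qed

section \<open>Cylinder sets and compactness of the full shift\<close>

definition agree :: "int \<Rightarrow> int \<Rightarrow> (int \<Rightarrow> 'a) \<Rightarrow> (int \<Rightarrow> 'a) \<Rightarrow> bool" where
  "agree a b x y \<longleftrightarrow> (\<forall>i. a \<le> i \<longrightarrow> i \<le> b \<longrightarrow> x i = y i)"

lemma agree_mono:
  "agree a b x y \<Longrightarrow> a \<le> a' \<Longrightarrow> b' \<le> b \<Longrightarrow>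
    agree a' b' x y"
  by (auto simp: agree_def)

text \<open>Central cylinders form a neighbourhood basis: a basic open set of the product restricts
  only finitely many coordinates, and a cylinder is a product of finitely many singletons and full
  factors.\<close>

lemma openin_full_shift_iff:
  "openin full_shift (U :: (int \<Rightarrow> 'a::finite) set) \<longleftrightarrow>
    (\<forall>x\<in>U. \<exists>N. \<forall>y. agree (-N) N x y \<longrightarrow> y \<in> U)"
proof (intro iffI ballI)
  fix x assume "openin full_shift U" "x \<in> U"
  then obtain W where W: "finite {i. W i \<noteq> UNIV}" "x \<in> Pi\<^sub>E UNIV W" "Pi\<^sub>E UNIV W \<subseteq> U"
    by (auto simp: full_shift_def openin_product_topology_alt)
  from W(1) obtain N where N: "\<And>i. W i \<noteq> UNIV \<Longrightarrow> \<bar>i\<bar> \<le> N"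
    using finite_imageI[of _ abs] by (metis (mono_tags, lifting) Max_ge imageI mem_Collect_eq)
  have "y \<in> U" if "agree (-N) N x y" for y
  proof -
    have "y i \<in> W i" for i
      using N[of i] that W(2) by (cases "W i = UNIV") (auto simp: agree_def PiE_iff abs_le_iff, metis minus_le_iff)
    then show ?thesis using W(3) by auto
  qed
  then show "\<exists>N. \<forall>y. agree (-N) N x y \<longrightarrow> y \<in> U" by blast
next
  assume R: "\<forall>x\<in>U. \<exists>N. \<forall>y. agree (-N) N x y \<longrightarrow> y \<in> U"
  show "openin full_shift U"
    unfolding full_shift_def openin_product_topology_alt
  proof (intro ballI)
    fix x assume "x \<in> U"
    with R obtain N where N: "\<And>y. agree (-N) N x y \<Longrightarrow> y \<in> U" by blast
    let ?W = "\<lambda>i. if i \<in> {-N..N} then {x i} else UNIV"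
    have "{i. ?W i \<noteq> UNIV} \<subseteq> {-N..N}" by auto
    then have "finite {i. ?W i \<noteq> UNIV}" by (rule finite_subset) simp
    moreover have "Pi\<^sub>E UNIV ?W \<subseteq> U"
      using N by (auto simp: agree_def PiE_iff split: if_splits)
    ultimately show "\<exists>W. finite {i \<in> UNIV. W i \<noteq> topspace (discrete_topology UNIV)} \<and>
        (\<forall>i\<in>UNIV. openin (discrete_topology UNIV) (W i)) \<and> x \<in> Pi\<^sub>E UNIV W \<and> Pi\<^sub>E UNIV W \<subseteq> U"
      by (intro exI[of _ ?W]) auto
  qed
qed

lemma compact_space_full_shift: "compact_space (full_shift :: (int \<Rightarrow> 'a::finite) topology)"
  by (simp add: full_shift_def compact_space_product_topology compact_space_discrete_topology)

text \<open>Compactness: the sets of points satisfying \<open>R N\<close> form an increasing open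
  cover, so the largest index of a finite subcover serves all points.\<close>

lemma full_shift_uniform_bound:
  fixes R :: "int \<Rightarrow> (int \<Rightarrow> 'a::finite) \<Rightarrow> bool"
  assumes op: "\<And>N. openin full_shift {x. R N x}"
    and mono: "\<And>N N' x. N \<le> N' \<Longrightarrow> R N x \<Longrightarrow> R N' x"
    and ex: "\<And>x. \<exists>N. R N x"
  obtains N where "\<And>x. R N x"
proof -
  have "\<forall>U\<in>range (\<lambda>N. {x. R N x}). openin full_shift U"
    using op by blast
  moreover have "topspace full_shift \<subseteq> \<Union> (range (\<lambda>N. {x. R N x}))"
    using ex by auto
  ultimately obtain \<F> where \<F>: "finite \<F>" "\<F> \<subseteq> range (\<lambda>N. {x. R N x})"
      "topspace full_shift \<subseteq> \<Union> \<F>"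
    using compact_space_full_shift unfolding compact_space_alt by meson
  from finite_subset_image[OF \<F>(1,2)] obtain S
    where S: "finite S" "\<F> = (\<lambda>N. {x. R N x}) ` S"
    by blast
  have "R (Max S) x" for x
  proof -
    have "x \<in> \<Union> \<F>" using \<F>(3) by auto
    then obtain N where N: "N \<in> S" "R N x" unfolding S(2) by blast
    show ?thesis by (rule mono[OF Max_ge[OF S(1) N(1)] N(2)])
  qed
  then show thesis by (rule that)
qed

text \<open>One coordinate of the Curtis-Hedlund-Lyndon theorem: a continuous map into a discrete
  alphabet is locally constant, and compactness makes the window uniform.\<close>

lemma continuous_map_coordinate_local:
  fixes \<phi> :: "(int \<Rightarrow> 'a::finite) \<Rightarrow> (int \<Rightarrow> 'a)"
  assumes "continuous_map full_shift full_shift \<phi>"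
  obtains N where "\<And>x y. agree (-N) N x y \<Longrightarrow> \<phi> x s = \<phi> y s"
proof -
  let ?R = "\<lambda>N x. \<forall>y. agree (-N) N x y \<longrightarrow> \<phi> y s = \<phi> x s"
  show thesis
  proof (rule full_shift_uniform_bound[of ?R])
    fix N
    have "?R N y" if "?R N x" "agree (-N) N x y" for x y
    proof (intro allI impI)
      fix z assume "agree (-N) N y z"
      with that(2) have "agree (-N) N x z" by (simp add: agree_def)
      with that show "\<phi> z s = \<phi> y s" by simp
    qed
    then show "openin full_shift {x. ?R N x}"
      unfolding openin_full_shift_iff mem_Collect_eq by blast
  next
    fix N N' x assume le: "N \<le> (N' :: int)" and R: "?R N x"
    show "?R N' x"
    proof (intro allI impI)
      fix y assume "agree (-N') N' x y"
      then have "agree (-N) N x y" using le by (simp add: agree_def)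
      with R show "\<phi> y s = \<phi> x s" by blast
    qed
  next
    fix x
    have "openin full_shift {y. y s = \<phi> x s}"
      unfolding openin_full_shift_iff agree_def
      by (auto intro!: exI[of _ "\<bar>s\<bar>"])
    then have "openin full_shift {y. \<phi> y s = \<phi> x s}"
      using openin_continuous_map_preimage[OF assms, of "{y. y s = \<phi> x s}"] by simp
    then show "\<exists>N. ?R N x" unfolding openin_full_shift_iff by blast
  next
    fix N assume "\<And>x. ?R N x"
    then show thesis by (intro that[of N]) metis
  qed
qed

section \<open>Blocks and states of a free action\<close>

definition translate :: "int \<Rightarrow> (int \<Rightarrow> 'a) \<Rightarrow> int \<Rightarrow> 'a" where
  "translate a x = (\<lambda>i. x (i + a))"

lemma translate_apply [simp]: "translate a x i = x (i + a)"
  by (simp add: translate_def)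

lemma translate_translate [simp]: "translate a (translate b x) = translate (a + b) x"
  by (simp add: translate_def add.assoc)

lemma translate_0 [simp]: "translate 0 x = x"
  by (simp add: translate_def)

lemma agree_translate:
  "agree a b (translate c x) (translate c y) \<longleftrightarrow> agree (a + c) (b + c) x y"
proof
  assume *: "agree a b (translate c x) (translate c y)"
  show "agree (a + c) (b + c) x y"
    unfolding agree_def
  proof (intro allI impI)
    fix i assume "a + c \<le> i" "i \<le> b + c"
    then show "x i = y i" using *[unfolded agree_def, rule_format, of "i - c"] by simp
  qed
qed (simp add: agree_def)

lemma funpow_shift: "shift ^^ n = translate (int n)"
  by (induction n) (auto simp: translate_def shift_def fun_eq_iff add.commute add.left_commute)

lemma translate_commute_mult:
  assumes commute: "\<And>x. f (translate a x) = translate a (f x)"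
  shows "f (translate (a * t) x) = translate (a * t) (f x)"
proof (induction t rule: int_induct[where k = 0])
  case base
  then show ?case by simp
next
  case (step1 t)
  have "f (translate (a * (t + 1)) x) = f (translate a (translate (a * t) x))"
    by (simp add: algebra_simps)
  also have "\<dots> = translate (a * (t + 1)) (f x)"
    unfolding commute step1(2) by (simp add: algebra_simps)
  finally show ?case .
next
  case (step2 t)
  have e: "a * (t - 1) = - a + a * t" by (simp add: algebra_simps)
  let ?y = "translate (- a + a * t) x"
  have "f ?y = translate (- a) (translate a (f ?y))"
    \<comment> \<open>Stepping down uses commutation at \<open>?y\<close>, whose translate by a is
      the point covered by the induction hypothesis.\<close>
    by (simp only: translate_translate) simp
  also have "translate a (f ?y) = translate (a * t) (f x)"
    unfolding commute[symmetric] step2(2)[symmetric] by (simp only: translate_translate) simp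
  also have "translate (- a) (translate (a * t) (f x)) = translate (- a + a * t) (f x)"
    by (simp only: translate_translate)
  finally show ?case unfolding e .
qed

lemma funpow_translate_commute:
  fixes f :: "(int \<Rightarrow> 'a) \<Rightarrow> int \<Rightarrow> 'a"
  assumes "\<And>x. f (translate a x) = translate a (f x)"
  shows "(f ^^ j) (translate a x) = translate a ((f ^^ j) x)"
  by (induction j) (auto simp: assms simp del: translate_apply)

lemma restrict_eq_iff: "restrict f A = restrict g A \<longleftrightarrow> (\<forall>i\<in>A. f i = g i)"
  by (auto simp: restrict_def fun_eq_iff)

text \<open>The map factors through restriction to the finite set S, and there are finitely many
  words on S.\<close>

lemma finite_image_if_local:
  fixes g :: "('i \<Rightarrow> 'a::finite) \<Rightarrow> 'b"
  assumes "finite S" and "\<And>x y. \<forall>i\<in>S. x i = y i \<Longrightarrow> g x = g y"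
  shows "finite (g ` A)"
proof (rule finite_subset)
  have "g x = g (restrict x S)" for x
    by (rule assms(2)) simp
  then show "g ` A \<subseteq> g ` (Pi\<^sub>E S (\<lambda>_. UNIV))"
    by (metis image_eqI image_subsetI restrict_PiE_iff UNIV_I)
  show "finite (g ` (Pi\<^sub>E S (\<lambda>_. UNIV)))"
    using assms(1) by (intro finite_imageI finite_PiE) auto
qed

text \<open>The radius r serves two purposes: it bounds the dependence of all iterates at all
  positions, and the window of radius r already separates a point from its proper iterates. Blocks
  have length 2M; a state reads only coordinates up to 2r in absolute value, hence less than
  M.\<close>

locale free_block_code =
  fixes \<phi> :: "(int \<Rightarrow> 'a::finite) \<Rightarrow> int \<Rightarrow> 'a" and m :: nat and M r :: int
  assumes m_pos: "m \<ge> 1"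
    and period: "\<And>x. (\<phi> ^^ m) x = x"
    and r_nonneg: "0 \<le> r" and M_large: "2 * r < M"
    and commute: "\<And>x. \<phi> (translate (2 * M) x) = translate (2 * M) (\<phi> x)"
    and local: "\<And>j s x y. agree (s - r) (s + r) x y \<Longrightarrow> (\<phi> ^^ j) x s = (\<phi> ^^ j) y s"
    and free: "\<And>j x. 0 < j \<Longrightarrow> j < m \<Longrightarrow> \<not> agree (-r) r ((\<phi> ^^ j) x) x"
begin

lemma period_mult: "(\<phi> ^^ (m * k)) x = x"
  using period by (induction k) (auto simp: funpow_add)

lemma funpow_commute: "(\<phi> ^^ j) (translate (2 * M * t) x) = translate (2 * M * t) ((\<phi> ^^ j) x)"
  by (rule translate_commute_mult, rule funpow_translate_commute, rule commute)

text \<open>All iterates are recorded, so that \<phi> acts on windows by shifting the index j. The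
  value \<open>undefined\<close> outside the interval turns equality of functions into equality of
  windows.\<close>

definition window :: "int \<Rightarrow> int \<Rightarrow> (int \<Rightarrow> 'a) \<Rightarrow> int \<Rightarrow> nat \<Rightarrow> 'a" where
  "window a b x = (\<lambda>s j. if a \<le> s \<and> s \<le> b then (\<phi> ^^ j) x s else undefined)"

lemma window_eq_iff:
  "window a b x = window a b y \<longleftrightarrow>
    (\<forall>j. agree a b ((\<phi> ^^ j) x) ((\<phi> ^^ j) y))"
  by (auto simp: window_def agree_def fun_eq_iff)

lemma window_eqD:
  "window a b x = window a b y \<Longrightarrow> a \<le> s \<Longrightarrow> s \<le> b \<Longrightarrow>
    (\<phi> ^^ j) x s = (\<phi> ^^ j) y s"
  by (simp add: window_eq_iff agree_def)

lemma window_eq_if_agree: "agree (a - r) (b + r) x y \<Longrightarrow> window a b x = window a b y"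
  by (auto simp: window_eq_iff agree_def intro!: local)

lemma window_mono:
  "window a b x = window a b y \<Longrightarrow> a \<le> a' \<Longrightarrow> b' \<le> b \<Longrightarrow>
    window a' b' x = window a' b' y"
  by (auto simp: window_eq_iff agree_def)

lemma window_funpow:
  "window a b x = window a b y \<Longrightarrow>
    window a b ((\<phi> ^^ k) x) = window a b ((\<phi> ^^ k) y)"
  by (simp add: window_eq_iff flip: funpow_add[unfolded fun_eq_iff comp_def, rule_format])

text \<open>Exponents are natural numbers, so the inverse of a power is written as a further power,
  completing k full turns.\<close>

lemma funpow_cancel: "(\<phi> ^^ (m * k - k)) ((\<phi> ^^ k) x) = x"
proof -
  have "k \<le> m * k" using m_pos by simp
  then show ?thesis using period_mult[of k x]
    by (simp flip: funpow_add[unfolded fun_eq_iff comp_def, rule_format])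
qed

lemma window_funpow_iff:
  "window a b ((\<phi> ^^ k) x) = window a b ((\<phi> ^^ k) y) \<longleftrightarrow>
    window a b x = window a b y"
  using window_funpow funpow_cancel by metis

lemma window_translate_iff:
  "window a b (translate (2 * M * t) x) = window a b (translate (2 * M * t) y) \<longleftrightarrow>
    window (a + 2 * M * t) (b + 2 * M * t) x = window (a + 2 * M * t) (b + 2 * M * t) y"
  unfolding window_eq_iff funpow_commute agree_translate ..

text \<open>
  Two points with the same state at the origin can be spliced there: by the choice of \<open>r\<close> every
  \<open>\<phi> ^^ j\<close> of the spliced point is the splice of the images.
\<close>

definition state :: "(int \<Rightarrow> 'a) \<Rightarrow> int \<Rightarrow> nat \<Rightarrow> 'a" where "state x = window (-r) r x"
definition states where "states = range state"
definition state_map :: "(int \<Rightarrow> nat \<Rightarrow> 'a) \<Rightarrow> int \<Rightarrow> nat \<Rightarrow> 'a" where "state_map v = (\<lambda>s j. v s (Suc j))"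
definition advance :: "(int \<Rightarrow> 'a) \<Rightarrow> int \<Rightarrow> 'a" where "advance = translate (2 * M)"
text \<open>The margin r on both sides puts the states at both ends inside the block; consecutive
  blocks overlap in a whole state.\<close>

definition block :: "(int \<Rightarrow> 'a) \<Rightarrow> int \<Rightarrow> nat \<Rightarrow> 'a" where "block x = window (-r) (2 * M + r) x"

lemma state_in_states [simp]: "state x \<in> states"
  by (simp add: states_def)

lemma finite_states: "finite states"
  unfolding states_def
  by (rule finite_image_if_local[of "{-2*r..2*r}"]) (auto simp: state_def agree_def intro!: window_eq_if_agree)

lemma state_phi: "state (\<phi> x) = state_map (state x)"
  by (auto simp: state_def window_def state_map_def fun_eq_iff funpow_swap1)

lemma state_funpow: "state ((\<phi> ^^ j) x) = (state_map ^^ j) (state x)"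
  by (induction j) (auto simp: state_phi)

lemma state_map_in_states: "v \<in> states \<Longrightarrow> state_map v \<in> states"
  by (metis states_def imageE rangeI state_phi)

lemma state_map_funpow_in_states: "v \<in> states \<Longrightarrow> (state_map ^^ j) v \<in> states"
  by (induction j) (auto simp: state_map_in_states)

lemma state_map_period: "v \<in> states \<Longrightarrow> (state_map ^^ m) v = v"
  unfolding states_def using state_funpow[of m] period by auto

lemma state_map_free:
  "v \<in> states \<Longrightarrow> 0 < j \<Longrightarrow> j < m \<Longrightarrow>
    (state_map ^^ j) v \<noteq> v"
proof
  assume v: "v \<in> states" "0 < j" "j < m" "(state_map ^^ j) v = v"
  then obtain x where "v = state x" by (auto simp: states_def)
  then have "state ((\<phi> ^^ j) x) = state x" using v state_funpow by simp
  then have "agree (-r) r ((\<phi> ^^ 0) ((\<phi> ^^ j) x)) ((\<phi> ^^ 0) x)"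
    unfolding state_def window_eq_iff by blast
  then show False using free v by simp
qed

lemma bij_state_map: "bij_betw state_map states states"
proof -
  have "inj_on state_map states"
  proof (rule inj_onI)
    fix v w assume "v \<in> states" "w \<in> states" "state_map v = state_map w"
    then show "v = w" using state_map_period m_pos
      by (metis Suc_diff_1 Suc_le_eq One_nat_def comp_apply funpow_Suc_right)
  qed
  moreover have "state_map ` states \<subseteq> states" using state_map_in_states by blast
  ultimately show ?thesis
    using finite_states by (simp add: bij_betw_def endo_inj_surj)
qed

lemma funpow_advance: "(\<phi> ^^ j) (advance x) = advance ((\<phi> ^^ j) x)"
  using funpow_commute[of j 1] by (simp add: advance_def)

lemma state_advance_iff:
  "state (advance x) = state (advance y) \<longleftrightarrow>
    window (2 * M - r) (2 * M + r) x = window (2 * M - r) (2 * M + r) y"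
  using window_translate_iff[of "-r" r 1] by (simp add: state_def advance_def add.commute)

lemma block_state: "block x = block y \<Longrightarrow> state x = state y"
  unfolding block_def state_def by (rule window_mono) (use r_nonneg M_large in auto)

lemma block_state_advance: "block x = block y \<Longrightarrow> state (advance x) = state (advance y)"
  unfolding block_def state_advance_iff by (rule window_mono) (use r_nonneg M_large in auto)

lemma state_eqD:
  "state x = state y \<Longrightarrow> -r \<le> s \<Longrightarrow> s \<le> r \<Longrightarrow>
    (\<phi> ^^ j) x s = (\<phi> ^^ j) y s"
  unfolding state_def by (rule window_eqD)

lemma state_eqD0:
  "state x = state y \<Longrightarrow> -r \<le> s \<Longrightarrow> s \<le> r \<Longrightarrow>
    x s = y s"
  using state_eqD[of x y s 0] by simp

section \<open>Splicing and gluing of points\<close>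

definition splice :: "int \<Rightarrow> (int \<Rightarrow> 'a) \<Rightarrow> (int \<Rightarrow> 'a) \<Rightarrow> int \<Rightarrow> 'a" where
  "splice a x y = (\<lambda>i. if i < a then x i else y i)"

lemma state_splice_0:
  assumes "state x = state y" shows "state (splice 0 x y) = state x"
  unfolding state_def window_eq_iff agree_def
proof (intro allI impI)
  fix j s assume s: "- r \<le> s" "s \<le> r"
  show "(\<phi> ^^ j) (splice 0 x y) s = (\<phi> ^^ j) x s"
  proof (cases "s \<le> 0")
    \<comment> \<open>Only coordinates up to r are read here. On 0..r the splice shows y, which
      equals x there because the states agree.\<close>
    case True
    show ?thesis
      by (rule local) (use True s state_eqD0[OF assms] in \<open>auto simp: agree_def splice_def\<close>)
  next
    case False
    have "(\<phi> ^^ j) (splice 0 x y) s = (\<phi> ^^ j) y s"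
      by (rule local) (use False s state_eqD0[OF assms] in \<open>auto simp: agree_def splice_def\<close>)
    then show ?thesis using state_eqD[OF assms s] by simp
  qed
qed

text \<open>By 2r < M the state at 0 is read strictly to the left of the cut and the state at 2M
  strictly to its right.\<close>

lemma state_splice_M: "state (splice M x y) = state x" "state (advance (splice M x y)) = state (advance y)"
  unfolding state_def advance_def
  by (rule window_eq_if_agree; use r_nonneg M_large in \<open>auto simp: agree_def splice_def\<close>)+

text \<open>The local pieces \<open>y t\<close> are given in coordinates relative to the position \<open>2 * M * t\<close>.\<close>

lemma glue:
  fixes y :: "int \<Rightarrow> int \<Rightarrow> 'a"
  assumes compat: "\<And>t. state (advance (y t)) = state (y (t + 1))"
  obtains x where "\<And>t. block (translate (2 * M * t) x) = block (y t)"
proof -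
  \<comment> \<open>The piece \<open>y t\<close> supplies the coordinates from 2Mt up to, but
    excluding, 2M(t+1).\<close>
  define x where "x = (\<lambda>i. y (i div (2 * M)) (i mod (2 * M)))"
  define z where "z t = translate (2 * M * t) x" for t
  have M: "0 < M" using r_nonneg M_large by simp
  have z: "z t i = y (t + u) (i - 2 * M * u)" if "2 * M * u \<le> i" "i < 2 * M * (u + 1)" for t u i
  proof -
    have "(i + 2 * M * t) div (2 * M) = t + u"
      by (rule int_div_pos_eq[where r = "i - 2 * M * u"]) (use that M in \<open>auto simp: algebra_simps\<close>)
    moreover have "(i + 2 * M * t) mod (2 * M) = i - 2 * M * u"
      by (rule int_mod_pos_eq[where q = "t + u"]) (use that M in \<open>auto simp: algebra_simps\<close>)
    ultimately show ?thesis by (simp add: z_def x_def)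
  qed
  \<comment> \<open>On the two overhangs of length r the glued point shows a neighbouring piece,
    which agrees with \<open>y t\<close> by compatibility of the states.\<close>
  have agr: "agree (-r) (2 * M + r) (z t) (y t)" for t
    unfolding agree_def
  proof (intro allI impI)
    fix i assume i: "- r \<le> i" "i \<le> 2 * M + r"
    consider "i < 0" | "0 \<le> i" "i < 2 * M" | "2 * M \<le> i" by linarith
    then show "z t i = y t i"
    proof cases
      case 1
      then have "z t i = y (t - 1) (i + 2 * M)"
        using z[of "-1" i t] i M_large r_nonneg by simp
      then show ?thesis
        using state_eqD0[OF compat[of "t - 1"], of i] i 1 r_nonneg by (simp add: advance_def)
    next
      case 2
      then show ?thesis using z[of 0 i t] by simp
    next
      case 3
      then have "z t i = y (t + 1) (i - 2 * M)"
        using z[of 1 i t] i M_large r_nonneg by simp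
      then show ?thesis
        using state_eqD0[OF compat[of t], of "i - 2 * M"] i 3 r_nonneg by (simp add: advance_def)
    qed
  qed
  \<comment> \<open>Iterates lose a margin r, so \<open>agr\<close> controls them only on 0..2M. The
    margins of the block are recovered from the neighbouring pieces through \<open>step\<close> and
    \<open>ystep\<close>.\<close>
  have mid: "(\<phi> ^^ j) (z t) s = (\<phi> ^^ j) (y t) s" if "0 \<le> s" "s \<le> 2 * M" for j t s
    by (rule local, rule agree_mono[OF agr]) (use that in auto)
  have step: "(\<phi> ^^ j) (z (t + 1)) s = (\<phi> ^^ j) (z t) (s + 2 * M)" for j t s
    unfolding z_def funpow_commute by (simp add: algebra_simps)
  have ystep: "(\<phi> ^^ j) (y (t + 1)) s = (\<phi> ^^ j) (y t) (s + 2 * M)" if "- r \<le> s" "s \<le> r" for j t s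
    using state_eqD[OF compat that, of j t] unfolding funpow_advance by (simp add: advance_def)
  have "block (z t) = block (y t)" for t
    unfolding block_def window_eq_iff agree_def
  proof (intro allI impI)
    fix j i assume i: "- r \<le> i" "i \<le> 2 * M + r"
    consider "i < 0" | "0 \<le> i" "i \<le> 2 * M" | "2 * M < i" by linarith
    then show "(\<phi> ^^ j) (z t) i = (\<phi> ^^ j) (y t) i"
    proof cases
      case 1
      then show ?thesis
        using step[of j "t - 1" i] ystep[of i j "t - 1"] mid[of "i + 2 * M" j "t - 1"] i M_large r_nonneg
        by simp
    next
      case 2
      then show ?thesis by (rule mid)
    next
      case 3
      then show ?thesis
        using step[of j t "i - 2 * M"] ystep[of "i - 2 * M" j t] mid[of "i - 2 * M" j "t + 1"]
          i M_large r_nonneg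
        by simp
    qed
  qed
  then show thesis by (intro that[of x]) (simp add: z_def)
qed

section \<open>Futures, pasts and the number of blocks\<close>

text \<open>
  Cutting at the midpoint \<open>M\<close> makes a block from \<open>v\<close> to \<open>w\<close> an independent choice of a future
  of \<open>v\<close> and a past of \<open>w\<close>, because the shift is full.
\<close>

definition futures where "futures v = (\<lambda>x. restrict x {0..<M}) ` {x. state x = v}"
definition pasts where "pasts v = (\<lambda>x. restrict x {-M..<0}) ` {x. state x = v}"
definition blocks where "blocks v w = block ` {x. state x = v \<and> state (advance x) = w}"

lemma finite_futures: "finite (futures v)"
  unfolding futures_def by (rule finite_image_if_local[of "{0..<M}"]) (auto simp: restrict_eq_iff)

lemma finite_pasts: "finite (pasts v)"
  unfolding pasts_def by (rule finite_image_if_local[of "{-M..<0}"]) (auto simp: restrict_eq_iff)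

lemma finite_blocks: "finite (blocks v w)"
  unfolding blocks_def
  by (rule finite_image_if_local[of "{-2*r..2*M+2*r}"]) (auto simp: block_def agree_def intro!: window_eq_if_agree)

lemma futures_nonempty: "v \<in> states \<Longrightarrow> futures v \<noteq> {}"
  by (auto simp: futures_def states_def)

lemma pasts_nonempty: "v \<in> states \<Longrightarrow> pasts v \<noteq> {}"
  by (auto simp: pasts_def states_def)

text \<open>Near the ends the iterates are given by the two states; at the remaining positions they
  read only coordinates in \<open>{0..<2*M}\<close>.\<close>

lemma block_eq_iff:
  assumes "state x = state y" "state (advance x) = state (advance y)"
  shows "block x = block y \<longleftrightarrow> (\<forall>i\<in>{0..<2*M}. x i = y i)"
proof
  assume "block x = block y"
  then show "\<forall>i\<in>{0..<2*M}. x i = y i"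
    unfolding block_def window_eq_iff agree_def using r_nonneg by (force dest: spec[of _ 0])
next
  assume *: "\<forall>i\<in>{0..<2*M}. x i = y i"
  show "block x = block y"
    unfolding block_def window_eq_iff agree_def
  proof (intro allI impI)
    fix j i assume i: "- r \<le> i" "i \<le> 2 * M + r"
    consider "i \<le> r" | "r < i" "i < 2 * M - r" | "2 * M - r \<le> i" by linarith
    then show "(\<phi> ^^ j) x i = (\<phi> ^^ j) y i"
    proof cases
      case 1
      then show ?thesis using state_eqD[OF assms(1)] i by simp
    next
      case 2
      show ?thesis by (rule local) (use 2 * in \<open>auto simp: agree_def\<close>)
    next
      case 3
      then show ?thesis using window_eqD[OF assms(2)[unfolded state_advance_iff]] i by simp
    qed
  qed
qed

lemma card_blocks: "card (blocks v w) = card (futures v) * card (pasts w)"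
proof -
  let ?A = "{x. state x = v \<and> state (advance x) = w}"
  \<comment> \<open>After \<open>advance\<close>, the second half of the block lies on
    \<open>{-M..<0}\<close>, where pasts are recorded.\<close>
  let ?g = "\<lambda>x. (restrict x {0..<M}, restrict (advance x) {-M..<0})"
  have M: "0 < M" using r_nonneg M_large by simp
  have "card (blocks v w) = card (?g ` ?A)"
    unfolding blocks_def
  proof (rule card_image_eq_if_same_kernel)
    fix x y assume xy: "x \<in> ?A" "y \<in> ?A"
    have "?g x = ?g y \<longleftrightarrow> (\<forall>i\<in>{0..<M}. x i = y i) \<and> (\<forall>i\<in>{-M..<0}. x (i + 2 * M) = y (i + 2 * M))"
      by (simp add: restrict_eq_iff advance_def)
    also have "(\<forall>i\<in>{-M..<0}. x (i + 2 * M) = y (i + 2 * M)) \<longleftrightarrow> (\<forall>i\<in>{M..<2*M}. x i = y i)"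
      by (auto dest: bspec[of _ _ "_ - 2 * M"])
    also have "(\<forall>i\<in>{0..<M}. x i = y i) \<and> (\<forall>i\<in>{M..<2*M}. x i = y i) \<longleftrightarrow> (\<forall>i\<in>{0..<2*M}. x i = y i)"
    proof -
      have "{0..<2*M} = {0..<M} \<union> {M..<2*M}" using M by auto
      then show ?thesis by (simp only: ball_Un)
    qed
    also have "\<dots> \<longleftrightarrow> block x = block y"
      using block_eq_iff xy by simp
    finally show "block x = block y \<longleftrightarrow> ?g x = ?g y" ..
  qed
  also have "?g ` ?A = futures v \<times> pasts w"
  proof
    show "?g ` ?A \<subseteq> futures v \<times> pasts w" by (auto simp: futures_def pasts_def)
    show "futures v \<times> pasts w \<subseteq> ?g ` ?A"
    proof clarify
      fix p q assume "p \<in> futures v" "q \<in> pasts w"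
      then obtain x y where x: "p = restrict x {0..<M}" "state x = v"
        and y: "q = restrict y {-M..<0}" "state y = w" by (auto simp: futures_def pasts_def)
      \<comment> \<open>The origin of y is moved to the right end of the block; the cut at M then
        keeps the future of x and the past of y.\<close>
      let ?y = "translate (-2 * M) y"
      have "advance ?y = y" by (simp add: advance_def)
      then have "splice M x ?y \<in> ?A" using state_splice_M[of x ?y] x y by simp
      moreover have "(p, q) = ?g (splice M x ?y)"
        unfolding x y by (auto simp: restrict_def splice_def advance_def fun_eq_iff)
      ultimately show "(p, q) \<in> ?g ` ?A" by (intro image_eqI[of _ ?g "splice M x ?y"])
    qed
  qed
  finally show ?thesis by (simp add: card_cartesian_product)
qed

text \<open>\<phi> carries the points with end states v, w onto those with the rotated end states,
  and it preserves and reflects equality of blocks.\<close>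

lemma card_blocks_state_map:
  assumes "v \<in> states" "w \<in> states"
  shows "card (blocks (state_map v) (state_map w)) = card (blocks v w)"
proof -
  let ?A = "{x. state x = v \<and> state (advance x) = w}"
  have advance\<phi>: "advance (\<phi> x) = \<phi> (advance x)" for x
    using funpow_advance[of 1 x] by simp
  have inj: "u = u'" if "u \<in> states" "u' \<in> states" "state_map u = state_map u'" for u u'
    using bij_state_map that by (auto simp: bij_betw_def inj_on_def)
  have "{x. state x = state_map v \<and> state (advance x) = state_map w} = \<phi> ` ?A"
  proof
    show "\<phi> ` ?A \<subseteq> {x. state x = state_map v \<and> state (advance x) = state_map w}"
      by (auto simp: state_phi advance\<phi>)
    show "{x. state x = state_map v \<and> state (advance x) = state_map w} \<subseteq> \<phi> ` ?A"
    proof clarify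
      fix x assume x: "state x = state_map v" "state (advance x) = state_map w"
      let ?y = "(\<phi> ^^ (m - 1)) x"
      have xy: "x = \<phi> ?y" using period[of x] m_pos
        by (metis Suc_diff_1 Suc_le_eq One_nat_def comp_apply funpow.simps(2))
      then have "state_map (state ?y) = state_map v" "state_map (state (advance ?y)) = state_map w"
        using x by (metis state_phi, metis state_phi advance\<phi>)
      then have "state ?y = v" "state (advance ?y) = w" using inj assms by auto
      then show "x \<in> \<phi> ` ?A" using xy by blast
    qed
  qed
  then have "blocks (state_map v) (state_map w) = (\<lambda>x. block (\<phi> x)) ` ?A"
    unfolding blocks_def by (simp add: image_image)
  moreover have "block (\<phi> x) = block (\<phi> y) \<longleftrightarrow> block x = block y" for x y
    unfolding block_def using window_funpow_iff[of _ _ 1] by simp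
  ultimately show ?thesis
    unfolding blocks_def by (simp add: card_image_eq_if_same_kernel[of ?A "\<lambda>x. block (\<phi> x)" block])
qed

text \<open>
  Since \<open>\<phi>\<close> preserves the numbers \<open>card (futures v) * card (pasts w)\<close>, summing over \<open>v\<close> cancels
  the first factor.
\<close>

lemma card_pasts_state_map:
  assumes "w \<in> states" shows "card (pasts (state_map w)) = card (pasts w)"
proof -
  have "(\<Sum>v\<in>states. card (futures v)) * card (pasts w) = (\<Sum>v\<in>states. card (blocks v w))"
    by (simp add: card_blocks sum_distrib_right)
  also have "\<dots> = (\<Sum>v\<in>states. card (blocks (state_map v) (state_map w)))"
    using card_blocks_state_map assms by simp
  also have "\<dots> = (\<Sum>v\<in>states. card (futures (state_map v))) * card (pasts (state_map w))"
    by (simp add: card_blocks sum_distrib_right)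
  also have "(\<Sum>v\<in>states. card (futures (state_map v))) = (\<Sum>v\<in>states. card (futures v))"
    by (rule sum.reindex_bij_betw[OF bij_state_map])
  finally have eq: "(\<Sum>v\<in>states. card (futures v)) * card (pasts w) = (\<Sum>v\<in>states. card (futures v)) * card (pasts (state_map w))" .
  have "card (futures w) \<le> (\<Sum>v\<in>states. card (futures v))"
    using assms finite_states by (intro member_le_sum) auto
  moreover have "0 < card (futures w)" using futures_nonempty[OF assms] finite_futures by (simp add: card_gt_0_iff)
  ultimately show ?thesis using eq by simp
qed

text \<open>In the count of blocks from v to itself the past factor is already invariant and
  positive, so it cancels.\<close>

lemma card_futures_state_map:
  assumes "v \<in> states" shows "card (futures (state_map v)) = card (futures v)"
proof -
  have "card (futures (state_map v)) * card (pasts v) = card (futures v) * card (pasts v)"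
    using card_blocks_state_map[OF assms assms] card_pasts_state_map[OF assms] by (simp add: card_blocks)
  moreover have "0 < card (pasts v)" using pasts_nonempty[OF assms] finite_pasts by (simp add: card_gt_0_iff)
  ultimately show ?thesis by simp
qed

lemma card_pasts_funpow: "v \<in> states \<Longrightarrow> card (pasts ((state_map ^^ j) v)) = card (pasts v)"
  by (induction j) (auto simp: card_pasts_state_map state_map_funpow_in_states)

lemma card_futures_funpow:
  "v \<in> states \<Longrightarrow>
    card (futures ((state_map ^^ j) v)) = card (futures v)"
  by (induction j) (auto simp: card_futures_state_map state_map_funpow_in_states)

text \<open>A word on \<open>{-M..<M}\<close> determines the state at the origin. For a given state
  the two halves are independent, since points with that state can be spliced at 0.\<close>

lemma sum_card_futures_pasts: "(\<Sum>v\<in>states. card (futures v) * card (pasts v)) = CARD('a) ^ nat (2 * M)"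
proof -
  have M: "0 < M" using r_nonneg M_large by simp
  let ?g = "\<lambda>x. (state x, restrict x {0..<M}, restrict x {-M..<0})"
  have "?g ` UNIV = Sigma states (\<lambda>v. futures v \<times> pasts v)"
  proof
    show "?g ` UNIV \<subseteq> Sigma states (\<lambda>v. futures v \<times> pasts v)" by (auto simp: futures_def pasts_def)
    show "Sigma states (\<lambda>v. futures v \<times> pasts v) \<subseteq> ?g ` UNIV"
    proof clarify
      fix v p q assume "v \<in> states" "p \<in> futures v" "q \<in> pasts v"
      then obtain x y where x: "p = restrict x {0..<M}" "state x = v"
        and y: "q = restrict y {-M..<0}" "state y = v" by (auto simp: futures_def pasts_def)
      then have "(v, p, q) = ?g (splice 0 y x)"
        using state_splice_0[of y x] by (auto simp: restrict_def splice_def fun_eq_iff)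
      then show "(v, p, q) \<in> ?g ` UNIV" by (intro image_eqI[of _ ?g "splice 0 y x"]) auto
    qed
  qed
  then have "(\<Sum>v\<in>states. card (futures v) * card (pasts v)) = card (?g ` UNIV)"
    using finite_states finite_pasts finite_futures by (simp add: card_SigmaI card_cartesian_product)
  also have "\<dots> = card ((\<lambda>x::int \<Rightarrow> 'a. restrict x {-M..<M}) ` UNIV)"
  proof (rule card_image_eq_if_same_kernel)
    fix x y :: "int \<Rightarrow> 'a"
    have "(\<forall>i\<in>{0..<M}. x i = y i) \<and> (\<forall>i\<in>{-M..<0}. x i = y i) \<longleftrightarrow> (\<forall>i\<in>{-M..<M}. x i = y i)"
    proof -
      have "{-M..<M} = {0..<M} \<union> {-M..<0}" using M by auto
      then show ?thesis by (simp only: ball_Un)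
    qed
    moreover have "state x = state y" if "\<forall>i\<in>{-M..<M}. x i = y i"
      unfolding state_def by (rule window_eq_if_agree) (use that M_large in \<open>auto simp: agree_def\<close>)
    ultimately show "?g x = ?g y \<longleftrightarrow> restrict x {-M..<M} = restrict y {-M..<M}"
      by (auto simp: restrict_eq_iff)
  qed
  also have "(\<lambda>x::int \<Rightarrow> 'a. restrict x {-M..<M}) ` UNIV = Pi\<^sub>E {-M..<M} (\<lambda>_. UNIV)"
  proof
    show "Pi\<^sub>E {-M..<M} (\<lambda>_. UNIV) \<subseteq> range (\<lambda>x::int \<Rightarrow> 'a. restrict x {-M..<M})"
      by (metis PiE_restrict rangeI subsetI)
  qed auto
  also have "card \<dots> = CARD('a) ^ nat (2 * M)"
    by (simp add: card_PiE)
  finally show ?thesis .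
qed

subsection \<open>The equivariant recoding\<close>

definition phase where
  "phase = (SOME d. \<forall>v\<in>states. d v < m \<and> d (state_map v) = Suc (d v) mod m)"

lemma phase: "v \<in> states \<Longrightarrow> phase v < m" "v \<in> states \<Longrightarrow> phase (state_map v) = Suc (phase v) mod m"
proof -
  have "\<exists>d. \<forall>v\<in>states. d v < m \<and> d (state_map v) = Suc (d v) mod m"
    by (rule cyclic_coordinate[of m states state_map])
      (use m_pos state_map_in_states state_map_period state_map_free in blast)+
  then have "\<forall>v\<in>states. phase v < m \<and> phase (state_map v) = Suc (phase v) mod m"
    unfolding phase_def by (rule someI_ex)
  then show "v \<in> states \<Longrightarrow> phase v < m" "v \<in> states \<Longrightarrow> phase (state_map v) = Suc (phase v) mod m"
    by auto
qed

lemma phase_funpow: "v \<in> states \<Longrightarrow> phase ((state_map ^^ j) v) = (phase v + j) mod m"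
  by (induction j) (simp_all add: phase state_map_funpow_in_states mod_Suc_eq)

definition base_states where "base_states = {v \<in> states. phase v = 0}"
text \<open>A label is what remains of a symbol besides its phase: a base state, a number for the
  block to the right and one for the block to the left.\<close>

definition labels where "labels = Sigma base_states (\<lambda>v. {..<card (futures v)} \<times> {..<card (pasts v)})"
definition K where "K = card labels"

lemma finite_labels: "finite labels"
  using finite_states by (auto simp: labels_def base_states_def)

text \<open>The base states are a fundamental domain of the free action: the phase recovers j, and
  then injectivity of the power recovers v.\<close>

lemma bij_levels: "bij_betw (\<lambda>(j, v). (state_map ^^ j) v) ({..<m} \<times> base_states) states"
  unfolding bij_betw_def
proof
  show "inj_on (\<lambda>(j, v). (state_map ^^ j) v) ({..<m} \<times> base_states)"
  proof (rule inj_onI, clarify)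
    fix i j v w assume *: "i < m" "j < m" "v \<in> base_states" "w \<in> base_states" "(state_map ^^ i) v = (state_map ^^ j) w"
    then have vw: "v \<in> states" "w \<in> states" "phase v = 0" "phase w = 0" by (auto simp: base_states_def)
    then have "i = j" using phase_funpow[of v i] phase_funpow[of w j] * by simp
    moreover have "inj_on (state_map ^^ i) states"
      using bij_betw_funpow[OF bij_state_map, of i] by (simp add: bij_betw_def)
    ultimately show "i = j \<and> v = w"
      using * vw by (simp add: inj_on_def)
  qed
  show "(\<lambda>(j, v). (state_map ^^ j) v) ` ({..<m} \<times> base_states) = states"
  proof
    show "(\<lambda>(j, v). (state_map ^^ j) v) ` ({..<m} \<times> base_states) \<subseteq> states"
      by (auto simp: base_states_def state_map_funpow_in_states)
    show "states \<subseteq> (\<lambda>(j, v). (state_map ^^ j) v) ` ({..<m} \<times> base_states)"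
    proof
      fix v assume v: "v \<in> states"
      let ?w = "(state_map ^^ (m - phase v)) v"
      have dv: "phase v < m" using phase(1)[OF v] .
      have "?w \<in> base_states" using phase_funpow[OF v] dv v by (simp add: base_states_def state_map_funpow_in_states)
      moreover have "v = (state_map ^^ phase v) ?w"
        using state_map_period[OF v] dv by (simp flip: funpow_add[unfolded fun_eq_iff comp_def, rule_format])
      ultimately show "v \<in> (\<lambda>(j, v). (state_map ^^ j) v) ` ({..<m} \<times> base_states)"
        using dv by (intro image_eqI[of _ _ "(phase v, ?w)"]) auto
    qed
  qed
qed

text \<open>The sum over all states is grouped by orbits, on which the summand is constant. Hence K
  depends only on m, M and the alphabet size, which is why two maps can share one coding
  alphabet.\<close>

lemma m_mult_K: "m * K = CARD('a) ^ nat (2 * M)"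
proof -
  have "CARD('a) ^ nat (2 * M) = (\<Sum>v\<in>states. card (futures v) * card (pasts v))"
    by (rule sum_card_futures_pasts[symmetric])
  also have "\<dots> = (\<Sum>(j, v)\<in>{..<m} \<times> base_states. card (futures ((state_map ^^ j) v)) * card (pasts ((state_map ^^ j) v)))"
    using sum.reindex_bij_betw[OF bij_levels, of "\<lambda>v. card (futures v) * card (pasts v)"]
    by (simp add: case_prod_unfold)
  also have "\<dots> = (\<Sum>(j, v)\<in>{..<m} \<times> base_states. card (futures v) * card (pasts v))"
    by (rule sum.cong) (auto simp: base_states_def card_futures_funpow card_pasts_funpow)
  also have "\<dots> = m * (\<Sum>v\<in>base_states. card (futures v) * card (pasts v))"
    by (simp flip: sum.cartesian_product)
  also have "(\<Sum>v\<in>base_states. card (futures v) * card (pasts v)) = K"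
    using finite_states unfolding K_def labels_def base_states_def
    by (simp add: card_SigmaI card_cartesian_product)
  finally show ?thesis ..
qed

text \<open>The numbering is arbitrary for each pair of states; equivariance comes from evaluating
  it at base points.\<close>

definition \<beta> where
  "\<beta> v w = (SOME b. bij_betw b (blocks v w) ({..<card (futures v)} \<times> {..<card (pasts w)}))"
definition \<eta> where "\<eta> = (SOME b. bij_betw b labels {..<K})"

lemma \<beta>: "bij_betw (\<beta> v w) (blocks v w) ({..<card (futures v)} \<times> {..<card (pasts w)})"
proof -
  have "\<exists>b. bij_betw b (blocks v w) ({..<card (futures v)} \<times> {..<card (pasts w)})"
    by (rule finite_same_card_bij) (simp_all add: finite_blocks card_blocks card_cartesian_product)
  then show ?thesis unfolding \<beta>_def by (rule someI_ex)
qed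

lemma \<eta>: "bij_betw \<eta> labels {..<K}"
proof -
  have "\<exists>b. bij_betw b labels {..<K}"
    by (rule finite_same_card_bij) (simp_all add: finite_labels K_def)
  then show ?thesis unfolding \<eta>_def by (rule someI_ex)
qed

text \<open>
  The \<open>\<phi>\<close>-invariant point \<open>base_point x\<close> is the member of the orbit of \<open>x\<close> whose state has phase 0. The
  pair \<open>fill x\<close> replaces the half-blocks on \<open>{0..<M}\<close> and \<open>{M..<2 * M}\<close> by numbers whose ranges are
  those of the futures of the left state and the pasts of the right state, so the symbol at a
  position combines the state there with one number from each of the two adjacent blocks.
\<close>

definition base_point :: "(int \<Rightarrow> 'a) \<Rightarrow> int \<Rightarrow> 'a" where "base_point x = (\<phi> ^^ (m - phase (state x))) x"
definition fill :: "(int \<Rightarrow> 'a) \<Rightarrow> nat \<times> nat" where "fill x = \<beta> (state x) (state (advance x)) (block x)"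
definition symbol :: "(int \<Rightarrow> 'a) \<Rightarrow> nat \<times> nat" where
  "symbol x = (phase (state x), \<eta> (state (base_point x), fst (fill (base_point x)), snd (fill (base_point (translate (- (2 * M)) x)))))"
definition coding :: "(int \<Rightarrow> 'a) \<Rightarrow> int \<Rightarrow> nat \<times> nat" where
  "coding x t = symbol (translate (2 * M * t) x)"

lemma phase_state [simp]: "phase (state x) < m"
  by (simp add: phase)

lemma phase_state_add [simp]: "phase (state x) + (m - phase (state x)) = m"
  using phase_state[of x] by linarith

lemma base_point_phi: "base_point (\<phi> x) = base_point x"
proof (cases "Suc (phase (state x)) < m")
  case True
  then have "m - phase (state x) = Suc (m - Suc (phase (state x)))" by simp
  then show ?thesis using True by (simp add: base_point_def state_phi phase funpow_swap1)
next
  case False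
  \<comment> \<open>At the wrap-around \<phi> x has phase 0, and its exponent is m, a full turn,
    instead of 0.\<close>
  then have "Suc (phase (state x)) = m" using phase_state[of x] by linarith
  then have "m - phase (state x) = 1" "phase (state (\<phi> x)) = 0" by (auto simp: state_phi phase)
  then show ?thesis by (simp add: base_point_def period)
qed

lemma funpow_base_point: "(\<phi> ^^ phase (state x)) (base_point x) = x"
  using period[of x] unfolding base_point_def
  by (simp flip: funpow_add[unfolded fun_eq_iff comp_def, rule_format])

lemma state_base_point: "state x = (state_map ^^ phase (state x)) (state (base_point x))"
  using funpow_base_point[of x] state_funpow[of "phase (state x)" "base_point x"] by simp

lemma phase_base_point: "phase (state (base_point x)) = 0"
  by (simp add: base_point_def state_funpow phase_funpow)

lemma state_base_point_in: "state (base_point x) \<in> base_states"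
  by (simp add: base_states_def phase_base_point)

lemma fill_bound: "fst (fill x) < card (futures (state x))" "snd (fill x) < card (pasts (state (advance x)))"
proof -
  have "block x \<in> blocks (state x) (state (advance x))" by (auto simp: blocks_def)
  then have "fill x \<in> {..<card (futures (state x))} \<times> {..<card (pasts (state (advance x)))}"
    unfolding fill_def using \<beta> bij_betwE by blast
  then show "fst (fill x) < card (futures (state x))" "snd (fill x) < card (pasts (state (advance x)))"
    by (auto simp: mem_Times_iff)
qed

text \<open>\<open>advance\<close> and \<open>base_point\<close> need not commute, because the
  rotation is taken from the phase at the left end. The two states still lie in one orbit, where the
  number of pasts is constant.\<close>

lemma card_pasts_advance_base_point:
  "card (pasts (state (advance (base_point x)))) = card (pasts (state (base_point (advance x))))"
  unfolding base_point_def funpow_advance[symmetric] state_funpow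
  by (simp add: card_pasts_funpow)

lemma label_in_labels:
  "(state (base_point x), fst (fill (base_point x)), snd (fill (base_point (translate (- (2 * M)) x)))) \<in> labels"
proof -
  have "advance (translate (- (2 * M)) x) = x" by (simp add: advance_def del: translate_apply)
  then show ?thesis
    using fill_bound[of "base_point x"] fill_bound(2)[of "base_point (translate (- (2 * M)) x)"]
      card_pasts_advance_base_point[of "translate (- (2 * M)) x"] state_base_point_in[of x]
    by (simp add: labels_def)
qed

lemma symbol_in: "symbol x \<in> {..<m} \<times> {..<K}"
  using label_in_labels[of x] \<eta> by (auto simp: symbol_def dest: bij_betwE)

text \<open>The label is built from base points, which \<phi> fixes, so only the phase
  moves.\<close>

lemma symbol_phi: "symbol (\<phi> x) = (Suc (fst (symbol x)) mod m, snd (symbol x))"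
proof -
  have "translate (- (2 * M)) (\<phi> x) = \<phi> (translate (- (2 * M)) x)"
    using funpow_commute[of 1 "-1" x] by (simp del: translate_apply)
  then show ?thesis by (simp add: symbol_def base_point_phi state_phi phase)
qed

lemma coding_phi: "coding (\<phi> x) t = (Suc (fst (coding x t)) mod m, snd (coding x t))"
  using funpow_commute[of 1 t x] by (simp add: coding_def symbol_phi[symmetric] del: translate_apply)

lemma coding_translate: "coding (translate (2 * M) x) t = coding x (t + 1)"
  by (simp add: coding_def algebra_simps del: translate_apply)

lemma pth_funpow_iff:
  "block ((\<phi> ^^ k) x) = block ((\<phi> ^^ k) y) \<longleftrightarrow>
    block x = block y"
  by (simp add: block_def window_funpow_iff)

lemma fill_cong: "block x = block y \<Longrightarrow> fill x = fill y"
  using block_state[of x y] block_state_advance[of x y] by (simp add: fill_def)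

lemma symbol_eqD:
  assumes "symbol x = symbol y"
  shows "state x = state y" "fst (fill (base_point x)) = fst (fill (base_point y))"
    "snd (fill (base_point (translate (- (2 * M)) x))) = snd (fill (base_point (translate (- (2 * M)) y)))"
proof -
  have "inj_on \<eta> labels" using \<eta> by (simp add: bij_betw_def)
  from inj_onD[OF this _ label_in_labels label_in_labels, of x y] assms
  have "phase (state x) = phase (state y)" and *: "state (base_point x) = state (base_point y) \<and> fst (fill (base_point x)) = fst (fill (base_point y)) \<and>
    snd (fill (base_point (translate (- (2 * M)) x))) = snd (fill (base_point (translate (- (2 * M)) y)))"
    by (auto simp: symbol_def simp del: translate_apply)
  then show "state x = state y" using state_base_point by metis
  show "fst (fill (base_point x)) = fst (fill (base_point y))"
    "snd (fill (base_point (translate (- (2 * M)) x))) = snd (fill (base_point (translate (- (2 * M)) y)))"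
    using * by blast+
qed

text \<open>The symbol at the left end holds the first number of the block and the symbol at the
  right end the second. Injectivity of \<open>\<beta>\<close> recovers the block of the base point,
  and the common phase undoes the rotation.\<close>

lemma symbol_determines_block:
  assumes "symbol x = symbol y" "symbol (advance x) = symbol (advance y)"
  shows "block x = block y"
proof -
  have advance: "translate (- (2 * M)) (advance z) = z" for z
    by (simp add: advance_def del: translate_apply)
  have fill: "fill (base_point x) = fill (base_point y)"
    using symbol_eqD(2)[OF assms(1)] symbol_eqD(3)[OF assms(2)] unfolding advance by (simp add: prod_eq_iff)
  have state: "state x = state y" "state (advance x) = state (advance y)"
    using symbol_eqD(1) assms by blast+
  then have state_base_point: "state (base_point x) = state (base_point y)" "state (advance (base_point x)) = state (advance (base_point y))"
    unfolding base_point_def funpow_advance[symmetric] by (simp_all add: state_funpow)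
  have inj: "inj_on (\<beta> (state (base_point y)) (state (advance (base_point y)))) (blocks (state (base_point y)) (state (advance (base_point y))))"
    using \<beta> by (simp add: bij_betw_def)
  have "block (base_point x) = block (base_point y)"
    by (rule inj_onD[OF inj]) (use fill state_base_point in \<open>auto simp: fill_def blocks_def\<close>)
  then show ?thesis
    using pth_funpow_iff[of "m - phase (state y)" x y] state(1) by (simp add: base_point_def)
qed

section \<open>The coding is a homeomorphism onto a full shift\<close>

lemma inj_coding: "inj coding"
proof (rule injI)
  fix x y assume "coding x = coding y"
  then have coding: "symbol (translate (2 * M * t) x) = symbol (translate (2 * M * t) y)" for t
    by (simp add: coding_def fun_eq_iff del: translate_apply)
  have M: "0 < M" using r_nonneg M_large by simp
  have "block (translate (2 * M * t) x) = block (translate (2 * M * t) y)" for t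
    using coding[of t] coding[of "t + 1"]
    by (intro symbol_determines_block) (simp_all add: advance_def algebra_simps del: translate_apply)
  then have "\<forall>i\<in>{0..<2*M}. translate (2 * M * t) x i = translate (2 * M * t) y i" for t
    using block_eq_iff block_state block_state_advance by blast
  then have *: "x (i + 2 * M * t) = y (i + 2 * M * t)" if "0 \<le> i" "i < 2 * M" for i t
    using that by simp
  have "x i = y i" for i
    using *[of "i mod (2 * M)" "i div (2 * M)"] M by simp
  then show "x = y" by blast
qed

text \<open>To decode z, read off the states, choose for each t a block at base level with the
  prescribed numbers, rotate it to the phase at t, and glue. The gluing condition holds because the
  rotated blocks have the prescribed states at both ends.\<close>

lemma range_coding: "range coding = Pi\<^sub>E UNIV (\<lambda>_. {..<m} \<times> {..<K})"
proof
  show "range coding \<subseteq> Pi\<^sub>E UNIV (\<lambda>_. {..<m} \<times> {..<K})"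
    using symbol_in by (auto simp: coding_def PiE_iff mem_Times_iff)
  show "Pi\<^sub>E UNIV (\<lambda>_. {..<m} \<times> {..<K}) \<subseteq> range coding"
  proof
    fix z :: "int \<Rightarrow> nat \<times> nat" assume z: "z \<in> Pi\<^sub>E UNIV (\<lambda>_. {..<m} \<times> {..<K})"
    define D where "D t = fst (z t)" for t
    have D: "D t < m" and "snd (z t) \<in> \<eta> ` labels" for t
      using z \<eta> unfolding D_def bij_betw_def by (auto simp: PiE_iff mem_Times_iff)
    then have "\<exists>v a b. (v, a, b) \<in> labels \<and> snd (z t) = \<eta> (v, a, b)" for t
      by fastforce
    then obtain v a b where T: "\<And>t. (v t, a t, b t) \<in> labels" and zeq: "\<And>t. snd (z t) = \<eta> (v t, a t, b t)"
      by metis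
    have v: "v t \<in> states" "phase (v t) = 0" and a: "a t < card (futures (v t))" and b: "b t < card (pasts (v t))" for t
      using T[of t] by (auto simp: labels_def base_states_def)
    define i where "i t = (state_map ^^ D t) (v t)" for t
    \<comment> \<open>The state at t + 1 as seen from base level of block t: rotation by
      \<open>D t\<close> carries it back to \<open>i (t + 1)\<close>.\<close>
    define w where "w t = (state_map ^^ (m - D t)) (i (t + 1))" for t
    have i: "i t \<in> states" for t by (simp add: i_def v state_map_funpow_in_states)
    \<comment> \<open>The second number of block t is stored in symbol t + 1, bounded by the pasts
      of \<open>v (t + 1)\<close>. Invariance along orbits makes it admissible for
      \<open>w t\<close>.\<close>
    have "card (pasts (w t)) = card (pasts (v (t + 1)))" for t
      by (simp add: w_def i_def v state_map_funpow_in_states card_pasts_funpow)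
    then have "(a t, b (t + 1)) \<in> \<beta> (v t) (w t) ` blocks (v t) (w t)" for t
      using \<beta>[of "v t" "w t"] a[of t] b[of "t + 1"] by (simp add: bij_betw_def)
    then have "\<exists>u. state u = v t \<and> state (advance u) = w t \<and> fill u = (a t, b (t + 1))" for t
      by (fastforce simp: blocks_def fill_def)
    then obtain u where u: "\<And>t. state (u t) = v t" "\<And>t. state (advance (u t)) = w t"
        "\<And>t. fill (u t) = (a t, b (t + 1))"
      by metis
    \<comment> \<open>The base-level blocks are rotated to their actual phases, so that neighbouring
      ends match.\<close>
    define y where "y t = (\<phi> ^^ D t) (u t)" for t
    have sty: "state (y t) = i t" for t by (simp add: y_def state_funpow u i_def)
    have "state (advance (y t)) = i (t + 1)" for t
    proof -
      have "state (advance (y t)) = (state_map ^^ D t) (w t)"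
        unfolding y_def funpow_advance[symmetric] by (simp add: state_funpow u)
      also have "\<dots> = (state_map ^^ m) (i (t + 1))"
        unfolding w_def using D[of t]
        by (simp flip: funpow_add[unfolded fun_eq_iff comp_def, rule_format])
      finally show ?thesis using state_map_period[OF i] by simp
    qed
    then obtain x where x: "\<And>t. block (translate (2 * M * t) x) = block (y t)"
      using glue[of y] sty by (metis (no_types, lifting))
    have stx: "state (translate (2 * M * t) x) = i t" for t
      using block_state[OF x] sty by simp
    have dx: "phase (state (translate (2 * M * t) x)) = D t" for t
      using D[of t] v[of t] by (simp only: stx i_def phase_funpow) simp
    have "block (base_point (translate (2 * M * t) x)) = block (u t)" for t
    proof -
      have "block (base_point (translate (2 * M * t) x)) = block ((\<phi> ^^ (m - D t)) (y t))"
        unfolding base_point_def dx pth_funpow_iff by (rule x)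
      also have "(\<phi> ^^ (m - D t)) (y t) = u t"
        unfolding y_def using D[of t] period[of "u t"]
        by (simp flip: funpow_add[unfolded fun_eq_iff comp_def, rule_format])
      finally show ?thesis .
    qed
    then have gx: "state (base_point (translate (2 * M * t) x)) = v t"
        "fill (base_point (translate (2 * M * t) x)) = (a t, b (t + 1))" for t
      using block_state fill_cong u by metis+
    have "coding x t = z t" for t
    proof -
      have "translate (- (2 * M)) (translate (2 * M * t) x) = translate (2 * M * (t - 1)) x"
        by (simp add: algebra_simps del: translate_apply)
      then have "coding x t = (D t, \<eta> (v t, a t, b t))"
        using gx(2)[of "t - 1"] by (simp add: coding_def symbol_def dx gx del: translate_apply)
      then show ?thesis by (simp add: D_def zeq[symmetric])
    qed
    then have zx: "z = coding x" by (simp add: fun_eq_iff)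
    show "z \<in> range coding" unfolding zx by (rule rangeI)
  qed
qed

text \<open>A symbol depends on the two blocks adjacent to the origin, and these read coordinates up
  to 2M + 2r < 4M in absolute value.\<close>

lemma symbol_local:
  assumes "agree (- (4 * M)) (4 * M) x y" shows "symbol x = symbol y"
proof -
  have 1: "block x = block y" unfolding block_def
    by (rule window_eq_if_agree, rule agree_mono[OF assms]) (use r_nonneg M_large in auto)
  let ?x = "translate (- (2 * M)) x" and ?y = "translate (- (2 * M)) y"
  have 2: "block ?x = block ?y" unfolding block_def
    by (rule window_eq_if_agree, unfold agree_translate, rule agree_mono[OF assms]) (use r_nonneg M_large in auto)
  have base_point: "block (base_point x) = block (base_point y)" if "block x = block y" for x y
    using that block_state[OF that] by (simp add: base_point_def pth_funpow_iff)
  show ?thesis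
    using block_state[OF 1] block_state[OF base_point[OF 1]] fill_cong[OF base_point[OF 1]] fill_cong[OF base_point[OF 2]]
    by (simp add: symbol_def del: translate_apply)
qed

lemma homeomorphic_map_coding:
  "homeomorphic_map full_shift (product_topology (\<lambda>_. discrete_topology ({..<m} \<times> {..<K})) UNIV) coding"
proof (rule continuous_imp_homeomorphic_map)
  show "compact_space (full_shift :: (int \<Rightarrow> 'a) topology)" by (rule compact_space_full_shift)
  show "Hausdorff_space (product_topology (\<lambda>_::int. discrete_topology ({..<m} \<times> {..<K})) UNIV)"
    by (simp add: Hausdorff_space_product_topology)
  show "continuous_map full_shift (product_topology (\<lambda>_. discrete_topology ({..<m} \<times> {..<K})) UNIV) coding"
    unfolding continuous_map_componentwise_UNIV
  proof
    fix t
    have "openin full_shift {x. coding x t \<in> U}" for U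
      unfolding openin_full_shift_iff
    proof (intro ballI exI allI impI)
      fix x y assume x: "x \<in> {x. coding x t \<in> U}"
        and "agree (- (4 * M + \<bar>2 * M * t\<bar>)) (4 * M + \<bar>2 * M * t\<bar>) x y"
      \<comment> \<open>Widening by the absolute value of 2Mt lets a central window contain the
        translated one.\<close>
      then have "agree (- (4 * M) + 2 * M * t) (4 * M + 2 * M * t) x y"
        by (auto elim!: agree_mono)
      then have "coding x t = coding y t"
        unfolding coding_def by (intro symbol_local) (simp only: agree_translate)
      with x show "y \<in> {x. coding x t \<in> U}" by simp
    qed
    then show "continuous_map full_shift (discrete_topology ({..<m} \<times> {..<K})) (\<lambda>x. coding x t)"
      using symbol_in by (auto simp: continuous_map_def coding_def)
  qed
  show "coding ` topspace full_shift = topspace (product_topology (\<lambda>_. discrete_topology ({..<m} \<times> {..<K})) UNIV)"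
    using range_coding by simp
  show "inj_on coding (topspace full_shift)"
    using inj_coding by simp
qed

end

section \<open>Conjugacy\<close>

lemma carrier_StabAutGroup_full_shift:
  "carrier (StabAutGroup full_shift shift) = stab_aut full_shift shift"
  by (simp add: StabAutGroup_def)

lemma bij_if_stab_aut: "\<phi> \<in> stab_aut full_shift shift \<Longrightarrow> bij \<phi>"
  by (auto simp: stab_aut_def aut_def Bij_def)

lemma mult_StabAutGroup_full_shift:
  assumes "\<phi> \<in> stab_aut full_shift shift" "\<psi> \<in> stab_aut full_shift shift"
  shows "\<phi> \<otimes>\<^bsub>StabAutGroup full_shift shift\<^esub> \<psi> = \<phi> \<circ> \<psi>"
  using assms
  by (auto simp: StabAutGroup_def BijGroup_def stab_aut_def aut_def compose_def fun_eq_iff)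

lemma group_full_shift: "group (StabAutGroup full_shift shift)"
  by (rule group_StabAutGroup) simp

lemma nat_pow_StabAutGroup_full_shift:
  assumes "\<phi> \<in> stab_aut full_shift shift"
  shows "\<phi> [^]\<^bsub>StabAutGroup full_shift shift\<^esub> (n::nat) = \<phi> ^^ n"
proof (induction n)
  case 0
  show ?case by (simp add: StabAutGroup_def BijGroup_def nat_pow_def fun_eq_iff)
next
  case (Suc n)
  interpret G: group "StabAutGroup full_shift shift" by (rule group_full_shift)
  have "\<phi> [^]\<^bsub>StabAutGroup full_shift shift\<^esub> n \<in> stab_aut full_shift shift"
    using G.nat_pow_closed assms unfolding carrier_StabAutGroup_full_shift .
  then show ?case
    using mult_StabAutGroup_full_shift[OF _ assms] Suc
    by (simp add: funpow_Suc_right del: funpow.simps)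
qed

text \<open>Since \<open>card\<close> is 0 on infinite sets and m is positive, the orbit is finite.
  The point is then periodic, and its orbit consists of exactly as many points as its least
  period.\<close>

lemma card_orbit_imp_period:
  assumes \<phi>: "\<phi> \<in> stab_aut full_shift shift"
    and card: "card (orbit_in (StabAutGroup full_shift shift) \<phi> x) = m" and m: "m \<ge> 1"
  shows "(\<phi> ^^ m) x = x" "0 < j \<Longrightarrow> j < m \<Longrightarrow> (\<phi> ^^ j) x \<noteq> x"
proof -
  let ?G = "StabAutGroup full_shift shift"
  interpret G: group ?G by (rule group_full_shift)
  let ?O = "orbit_in ?G \<phi> x"
  have \<phi>G: "\<phi> \<in> carrier ?G" using \<phi> by (simp add: carrier_StabAutGroup_full_shift)
  have inj: "inj (\<phi> ^^ n)" for n
    using bij_if_stab_aut[OF \<phi>] by (simp add: bij_fn bij_is_inj)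
  have pow: "\<phi> [^]\<^bsub>?G\<^esub> int n = \<phi> ^^ n" for n
    using nat_pow_StabAutGroup_full_shift[OF \<phi>] by (simp add: int_pow_int)
  have pow_in: "\<phi> [^]\<^bsub>?G\<^esub> i \<in> stab_aut full_shift shift" for i :: int
    using G.int_pow_closed[OF \<phi>G] unfolding carrier_StabAutGroup_full_shift .
  have fin: "finite ?O" using card m by (intro card_ge_0_finite) simp
  have O: "(\<phi> ^^ n) x \<in> ?O" for n
    unfolding orbit_in_def using pow[of n] by (auto intro!: exI[of _ "int n"])
  then have "finite (range (\<lambda>n. (\<phi> ^^ n) x))"
    by (intro finite_subset[OF _ fin]) auto
  then have "\<not> inj (\<lambda>n. (\<phi> ^^ n) x)"
    using finite_imageD infinite_UNIV_nat by blast
  then obtain a b where ab: "a < b" "(\<phi> ^^ a) x = (\<phi> ^^ b) x"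
    unfolding inj_def by (metis linorder_neqE_nat)
  then have "(\<phi> ^^ a) ((\<phi> ^^ (b - a)) x) = (\<phi> ^^ a) x"
    by (simp flip: funpow_add[unfolded fun_eq_iff comp_def, rule_format])
  then have "(\<phi> ^^ (b - a)) x = x" using inj by (simp add: inj_def)
  then have ex: "\<exists>p. 0 < p \<and> (\<phi> ^^ p) x = x" using ab(1) by (intro exI[of _ "b - a"]) simp
  define p where "p = (LEAST p. 0 < p \<and> (\<phi> ^^ p) x = x)"
  have p: "0 < p" "(\<phi> ^^ p) x = x"
    using LeastI_ex[OF ex] unfolding p_def by auto
  have least: "(\<phi> ^^ j) x \<noteq> x" if "0 < j" "j < p" for j
    using not_less_Least that unfolding p_def by blast
  have "?O = (\<lambda>j. (\<phi> ^^ j) x) ` {..<p}"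
  proof
    show "(\<lambda>j. (\<phi> ^^ j) x) ` {..<p} \<subseteq> ?O" using O by blast
    show "?O \<subseteq> (\<lambda>j. (\<phi> ^^ j) x) ` {..<p}"
    proof
      fix z assume "z \<in> ?O"
      then obtain n :: int where z: "z = (\<phi> [^]\<^bsub>?G\<^esub> n) x" unfolding orbit_in_def by blast
      \<comment> \<open>A multiple of the period large enough to make the exponent n + N
        nonnegative.\<close>
      define N where "N = p * nat \<bar>n\<bar>"
      have "\<bar>n\<bar> \<le> int p * \<bar>n\<bar>" using p(1) by (simp add: mult_le_cancel_right1)
      then have "0 \<le> n + int N" by (simp add: N_def)
      then obtain k where k: "n + int N = int k" using nonneg_int_cases by blast
      have "(\<phi> ^^ N) x = x"
        using funpow_mod_eq[OF p(2), of N] by (simp add: N_def)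
      then have "z = (\<phi> [^]\<^bsub>?G\<^esub> n) ((\<phi> [^]\<^bsub>?G\<^esub> int N) x)" unfolding pow z by simp
      also have "\<dots> = (\<phi> [^]\<^bsub>?G\<^esub> n \<otimes>\<^bsub>?G\<^esub> \<phi> [^]\<^bsub>?G\<^esub> int N) x"
        unfolding mult_StabAutGroup_full_shift[OF pow_in pow_in] by simp
      also have "\<dots> = (\<phi> ^^ k) x"
        unfolding G.int_pow_mult[OF \<phi>G, symmetric] unfolding k pow ..
      also have "\<dots> = (\<phi> ^^ (k mod p)) x" by (rule funpow_mod_eq[OF p(2), symmetric])
      finally show "z \<in> (\<lambda>j. (\<phi> ^^ j) x) ` {..<p}" using p(1) by auto
    qed
  qed
  moreover have "inj_on (\<lambda>j. (\<phi> ^^ j) x) {..<p}"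
  proof (rule linorder_inj_onI)
    fix i j assume ij: "i < j" "i \<in> {..<p}" "j \<in> {..<p}"
    show "(\<phi> ^^ i) x \<noteq> (\<phi> ^^ j) x"
    proof
      assume "(\<phi> ^^ i) x = (\<phi> ^^ j) x"
      with ij(1) have "(\<phi> ^^ i) ((\<phi> ^^ (j - i)) x) = (\<phi> ^^ i) x"
        by (simp flip: funpow_add[unfolded fun_eq_iff comp_def, rule_format])
      then have "(\<phi> ^^ (j - i)) x = x" using inj by (simp add: inj_def)
      then show False using least[of "j - i"] ij by (simp add: less_imp_diff_less)
    qed
  qed auto
  ultimately have "p = m" using card by (simp add: card_image)
  then show "(\<phi> ^^ m) x = x" "0 < j \<Longrightarrow> j < m \<Longrightarrow> (\<phi> ^^ j) x \<noteq> x"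
    using p least by auto
qed

text \<open>The exponent reduces modulo m by periodicity and the position modulo n by commutation,
  so only finitely many windows occur.\<close>

lemma uniform_radius:
  fixes \<phi> :: "(int \<Rightarrow> 'a::finite) \<Rightarrow> (int \<Rightarrow> 'a)"
  assumes cont: "continuous_map full_shift full_shift \<phi>"
    and n: "n \<ge> 1"
    and commute: "\<And>x. \<phi> (translate (int n) x) = translate (int n) (\<phi> x)"
    and m: "m \<ge> 1" and period: "\<And>x. (\<phi> ^^ m) x = x"
  obtains R where "\<And>j s x y. agree (s - R) (s + R) x y \<Longrightarrow> (\<phi> ^^ j) x s = (\<phi> ^^ j) y s"
proof -
  have contj: "continuous_map full_shift full_shift (\<phi> ^^ j)" for j
  proof (induction j)
    case (Suc j)
    then show ?case
      unfolding funpow.simps by (rule continuous_map_compose[OF _ cont])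
  qed (simp add: id_def[symmetric])
  have "\<exists>N. \<forall>x y. agree (-N) N x y \<longrightarrow> (\<phi> ^^ j) x s = (\<phi> ^^ j) y s" for j s
    by (rule continuous_map_coordinate_local[OF contj[of j], of s]) blast
  then obtain N where N: "\<And>j s x y. agree (- N j s) (N j s) x y \<Longrightarrow> (\<phi> ^^ j) x s = (\<phi> ^^ j) y s"
    by metis
  define B where "B = Max ((\<lambda>(j, s). N j s) ` ({..<m} \<times> {0..<int n}))"
  have B: "N j s \<le> B" if "j < m" "0 \<le> s" "s < int n" for j s
    unfolding B_def using that by (intro Max_ge) auto
  \<comment> \<open>The windows \<open>N j s\<close> are centred at 0, not at s; the extra n covers
    the offset of the reduced position.\<close>
  have "(\<phi> ^^ j) x s = (\<phi> ^^ j) y s" if agr: "agree (s - (B + int n)) (s + (B + int n)) x y" for j s x y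
  proof -
    define j' s' c where "j' = j mod m" and "s' = s mod int n" and "c = int n * (s div int n)"
    have j': "j' < m" and s': "0 \<le> s'" "s' < int n" using m n by (auto simp: j'_def s'_def)
    have s: "s = s' + c" by (simp add: s'_def c_def)
    have red: "(\<phi> ^^ j) z s = (\<phi> ^^ j') (translate c z) s'" for z
    proof -
      have "(\<phi> ^^ j') (translate c z) s' = translate c ((\<phi> ^^ j') z) s'"
        unfolding c_def
        by (rule fun_cong, rule translate_commute_mult, rule funpow_translate_commute, rule commute)
      also have "\<dots> = (\<phi> ^^ j') z s" by (simp add: s)
      also have "\<dots> = (\<phi> ^^ j) z s"
        unfolding j'_def using funpow_mod_eq[OF period] by simp
      finally show ?thesis ..
    qed
    show ?thesis
      unfolding red
    proof (rule N)
      show "agree (- N j' s') (N j' s') (translate c x) (translate c y)"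
        unfolding agree_translate
        by (rule agree_mono[OF agr]) (use B[OF j' s'] s' s in auto)
    qed
  qed
  then show thesis by (rule that)
qed

text \<open>That a point differs from its iterate within a given window is an open condition, since
  iterates are local. Compactness gives a window for each j, and there are finitely many j.\<close>

lemma uniform_freeness:
  fixes \<phi> :: "(int \<Rightarrow> 'a::finite) \<Rightarrow> (int \<Rightarrow> 'a)"
  assumes local: "\<And>j s x y. agree (s - R) (s + R) x y \<Longrightarrow> (\<phi> ^^ j) x s = (\<phi> ^^ j) y s"
    and free: "\<And>j x. 0 < j \<Longrightarrow> j < m \<Longrightarrow> (\<phi> ^^ j) x \<noteq> x"
  obtains N where "\<And>j x. 0 < j \<Longrightarrow> j < m \<Longrightarrow> \<not> agree (-N) N ((\<phi> ^^ j) x) x"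
proof -
  have "\<exists>N. \<forall>x. \<not> agree (-N) N ((\<phi> ^^ j) x) x" if j: "0 < j" "j < m" for j
  proof (rule full_shift_uniform_bound[of "\<lambda>N x. \<not> agree (-N) N ((\<phi> ^^ j) x) x"])
    fix N
    show "openin full_shift {x. \<not> agree (-N) N ((\<phi> ^^ j) x) x}"
      unfolding openin_full_shift_iff
    proof (intro ballI exI allI impI)
      fix x y assume x: "x \<in> {x. \<not> agree (-N) N ((\<phi> ^^ j) x) x}"
        and "agree (- (N + \<bar>R\<bar>)) (N + \<bar>R\<bar>) x y"
      then have "agree (-N) N ((\<phi> ^^ j) y) ((\<phi> ^^ j) x)" "agree (-N) N x y"
        by (auto simp: agree_def intro!: local)
      with x show "y \<in> {x. \<not> agree (-N) N ((\<phi> ^^ j) x) x}"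
        by (auto simp: agree_def)
    qed
  next
    fix N N' x assume "N \<le> (N' :: int)" "\<not> agree (-N) N ((\<phi> ^^ j) x) x"
    then show "\<not> agree (-N') N' ((\<phi> ^^ j) x) x"
      using agree_mono[of "-N'" N' _ _ "-N" N] by auto
  next
    fix x
    obtain i where "(\<phi> ^^ j) x i \<noteq> x i" using free[OF j] by blast
    then have "\<not> agree (- \<bar>i\<bar>) \<bar>i\<bar> ((\<phi> ^^ j) x) x"
      by (auto simp: agree_def intro!: exI[of _ i])
    then show "\<exists>N. \<not> agree (-N) N ((\<phi> ^^ j) x) x" by blast
  qed blast
  then obtain N where N: "\<And>j x. 0 < j \<Longrightarrow> j < m \<Longrightarrow> \<not> agree (- N j) (N j) ((\<phi> ^^ j) x) x"
    by metis
  define B where "B = Max (N ` {..<m})"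
  have "\<not> agree (-B) B ((\<phi> ^^ j) x) x" if "0 < j" "j < m" for j x
  proof -
    have "N j \<le> B" unfolding B_def using that by (intro Max_ge) auto
    then show ?thesis using N[OF that] agree_mono[of "-B" B _ _ "- N j" "N j"] by auto
  qed
  then show thesis by (rule that)
qed

text \<open>The half-length is a multiple of n, which gives commutation, and exceeds 2r. It is a
  function of n and r alone, and every large r is allowed, so two maps can use the same
  values.\<close>

lemma free_block_code_eventually:
  fixes \<phi> :: "(int \<Rightarrow> 'a::finite) \<Rightarrow> (int \<Rightarrow> 'a)"
  assumes \<phi>: "\<phi> \<in> aut full_shift (shift ^^ n)" and n: "n \<ge> 1" and m: "m \<ge> 1"
    and period: "\<And>x. (\<phi> ^^ m) x = x"
    and free: "\<And>j x. 0 < j \<Longrightarrow> j < m \<Longrightarrow> (\<phi> ^^ j) x \<noteq> x"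
  obtains R where "\<And>r. R \<le> r \<Longrightarrow> free_block_code \<phi> m (int n * (2 * r + 1)) r"
proof -
  have commute: "\<phi> (translate (int n) x) = translate (int n) (\<phi> x)" for x
    using \<phi> by (simp add: aut_def funpow_shift del: translate_apply)
  have cont: "continuous_map full_shift full_shift \<phi>"
    using \<phi> by (simp add: aut_def homeomorphic_imp_continuous_map)
  obtain R1 where R1: "\<And>j s x y. agree (s - R1) (s + R1) x y \<Longrightarrow> (\<phi> ^^ j) x s = (\<phi> ^^ j) y s"
    using uniform_radius[OF cont n commute m period] by blast
  obtain R2 where R2: "\<And>j x. 0 < j \<Longrightarrow> j < m \<Longrightarrow> \<not> agree (-R2) R2 ((\<phi> ^^ j) x) x"
    using uniform_freeness[of R1 \<phi> m, OF R1 free] by blast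
  have "free_block_code \<phi> m (int n * (2 * r + 1)) r" if r: "max 0 (max R1 R2) \<le> r" for r
  proof
    show "2 * r < int n * (2 * r + 1)"
    proof -
      have "1 * (2 * r + 1) \<le> int n * (2 * r + 1)"
        by (rule mult_right_mono) (use r n in auto)
      then show ?thesis by simp
    qed
    show "\<phi> (translate (2 * (int n * (2 * r + 1))) x) = translate (2 * (int n * (2 * r + 1))) (\<phi> x)" for x
      using translate_commute_mult[of \<phi> "int n" "2 * (2 * r + 1)", OF commute]
      by (simp add: ac_simps del: translate_apply)
    show "(\<phi> ^^ j) x s = (\<phi> ^^ j) y s" if "agree (s - r) (s + r) x y" for j s x y
      by (rule R1, rule agree_mono[OF that]) (use r in auto)
    show "\<not> agree (-r) r ((\<phi> ^^ j) x) x" if "0 < j" "j < m" for j x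
      using R2[OF that] agree_mono[of "-r" r _ _ "-R2" R2] r by auto
  qed (use r m period in auto)
  then show thesis by (rule that)
qed

theorem corollary6p4:
  fixes k m :: nat
    and \<phi>\<^sub>1 \<phi>\<^sub>2 :: "(int \<Rightarrow> 'a::finite) \<Rightarrow> (int \<Rightarrow> 'a)"
  defines "G \<equiv> StabAutGroup full_shift shift"
  assumes "k \<ge> 1" and "m \<ge> 1" and "CARD('a) = k"
    and "\<phi>\<^sub>1 \<in> carrier G" and "\<phi>\<^sub>2 \<in> carrier G"
    and "\<And>x. card (orbit_in G \<phi>\<^sub>1 x) = m"
    and "\<And>x. card (orbit_in G \<phi>\<^sub>2 x) = m"
  shows "\<exists>\<psi>\<in>carrier G. \<phi>\<^sub>2 = \<psi> \<otimes>\<^bsub>G\<^esub> \<phi>\<^sub>1 \<otimes>\<^bsub>G\<^esub> inv\<^bsub>G\<^esub> \<psi>"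
proof -
  interpret G: group G unfolding G_def by (rule group_full_shift)
  have G: "carrier G = stab_aut full_shift shift"
    by (simp add: G_def carrier_StabAutGroup_full_shift)
  have \<phi>: "\<phi>\<^sub>1 \<in> stab_aut full_shift shift" "\<phi>\<^sub>2 \<in> stab_aut full_shift shift"
    using assms(5,6) G by auto
  then obtain n1 n2 where n1: "n1 \<ge> 1" "\<phi>\<^sub>1 \<in> aut full_shift (shift ^^ n1)"
    and n2: "n2 \<ge> 1" "\<phi>\<^sub>2 \<in> aut full_shift (shift ^^ n2)"
    by (auto simp: stab_aut_def)
  \<comment> \<open>A common power of the shift with which both maps commute.\<close>
  define n where "n = n1 * n2"
  have n: "n \<ge> 1" using n1 n2 by (simp add: n_def)
  have aut: "\<phi>\<^sub>1 \<in> aut full_shift (shift ^^ n)" "\<phi>\<^sub>2 \<in> aut full_shift (shift ^^ n)"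
    using n1 n2 aut_mono_power[of shift full_shift n1 n2] aut_mono_power[of shift full_shift n2 n1]
    by (auto simp: n_def mult.commute)
  note orbit1 = card_orbit_imp_period[OF \<phi>(1) assms(7)[unfolded G_def] \<open>m \<ge> 1\<close>]
  note orbit2 = card_orbit_imp_period[OF \<phi>(2) assms(8)[unfolded G_def] \<open>m \<ge> 1\<close>]
  obtain R1 where R1: "\<And>r. R1 \<le> r \<Longrightarrow> free_block_code \<phi>\<^sub>1 m (int n * (2 * r + 1)) r"
    using free_block_code_eventually[OF aut(1) n \<open>m \<ge> 1\<close> orbit1] by blast
  obtain R2 where R2: "\<And>r. R2 \<le> r \<Longrightarrow> free_block_code \<phi>\<^sub>2 m (int n * (2 * r + 1)) r"
    using free_block_code_eventually[OF aut(2) n \<open>m \<ge> 1\<close> orbit2] by blast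
  define r where "r = max R1 R2"
  define M where "M = int n * (2 * r + 1)"
  interpret c1: free_block_code \<phi>\<^sub>1 m M r unfolding M_def by (rule R1) (simp add: r_def)
  interpret c2: free_block_code \<phi>\<^sub>2 m M r unfolding M_def by (rule R2) (simp add: r_def)
  have K: "c1.K = c2.K"
    using c1.m_mult_K c2.m_mult_K \<open>m \<ge> 1\<close> by (metis mult_cancel1 not_one_le_zero)
  let ?Z = "product_topology (\<lambda>_::int. discrete_topology ({..<m} \<times> {..<c2.K})) UNIV"
  have hom1: "homeomorphic_map full_shift ?Z c1.coding"
    using c1.homeomorphic_map_coding unfolding K .
  obtain h' where h': "homeomorphic_maps full_shift ?Z c2.coding h'"
    using c2.homeomorphic_map_coding homeomorphic_map_maps by blast
  \<comment> \<open>Encode with the coding of the first map and decode with that of the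
    second.\<close>
  define \<psi> where "\<psi> = h' \<circ> c1.coding"
  have hom: "homeomorphic_map full_shift full_shift \<psi>"
    unfolding \<psi>_def
    using homeomorphic_map_compose[OF hom1] h' homeomorphic_maps_map homeomorphic_maps_sym by blast
  have h_\<psi>: "c2.coding (\<psi> x) = c1.coding x" for x
  proof -
    have "c1.coding x \<in> topspace ?Z" using c1.range_coding unfolding K by auto
    then show ?thesis using h' by (simp add: homeomorphic_maps_def \<psi>_def)
  qed
  have translate: "\<psi> (translate (2 * M) x) = translate (2 * M) (\<psi> x)" for x
    by (rule injD[OF c2.inj_coding])
      (simp add: fun_eq_iff h_\<psi> c1.coding_translate c2.coding_translate del: translate_apply)
  \<comment> \<open>Both codings turn their map into the same rotation of the phase, so the two
    sides have equal codes.\<close>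
  have conj: "\<phi>\<^sub>2 (\<psi> x) = \<psi> (\<phi>\<^sub>1 x)" for x
    by (rule injD[OF c2.inj_coding]) (simp add: fun_eq_iff h_\<psi> c1.coding_phi c2.coding_phi)
  have M: "0 < M" using c1.r_nonneg c1.M_large by simp
  have "\<psi> \<in> aut full_shift (shift ^^ nat (2 * M))"
    using hom translate M homeomorphic_imp_injective_map[OF hom] homeomorphic_imp_surjective_map[OF hom]
    by (simp add: aut_def Bij_def funpow_shift bij_betw_def del: translate_apply)
  then have \<psi>: "\<psi> \<in> stab_aut full_shift shift"
    unfolding stab_aut_def using M by (intro UN_I[of "nat (2 * M)"]) auto
  have "\<phi>\<^sub>2 \<otimes>\<^bsub>G\<^esub> \<psi> = \<psi> \<otimes>\<^bsub>G\<^esub> \<phi>\<^sub>1"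
    unfolding G_def using conj \<phi> \<psi> by (simp add: mult_StabAutGroup_full_shift fun_eq_iff)
  then have "\<phi>\<^sub>2 = \<psi> \<otimes>\<^bsub>G\<^esub> \<phi>\<^sub>1 \<otimes>\<^bsub>G\<^esub> inv\<^bsub>G\<^esub> \<psi>"
    using G.inv_solve_right[of \<phi>\<^sub>2 "\<psi> \<otimes>\<^bsub>G\<^esub> \<phi>\<^sub>1" \<psi>] G.m_closed[of \<psi> \<phi>\<^sub>1] \<phi> \<psi>
    unfolding G by simp
  then show ?thesis using \<psi> G by blast
qed

end
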